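(* Let $(\sigma,\alpha)$ be a planar hypermap, represented by its paper model. Perform the cutting procedure subject to the rules (R1)–(R4) in all possible ways, and associate to each outcome the weight $u^{a}v^{b}$, where $a$ is the number of wet coastlines and $b$ is the number of dry faces of the outcome. Then the sum of the weights of all outcomes is $u\cdot R(\sigma,\alpha;u,v)$, where $R(\sigma,\alpha;u,v)$ is the Whitney polynomial of $(\sigma,\alpha)$.
   Context: Permutations act on a finite set and are composed from right to left; $z(\pi)$ is the number of cycles of $\pi$ (fixed points included). A collection of hypermaps on $\{1,\ldots,n\}$ is an ordered pair $(\sigma,\alpha)$ of permutations; $\kappa(\sigma,\alpha)$ is the number of orbits (connected components) of the group they generate; it is a hypermap if $\kappa(\sigma,\alpha)=1$. A hypermap is planar if its genus is $0$, where $n+2-2g(\sigma,\alpha)=z(\sigma)+z(\alpha)+z(\alpha^{-1}\sigma)$. The cycles of $\sigma$, $\alpha$, $\alpha^{-1}\sigma$ are the vertices, hyperedges and faces. A permutation $\beta$ is a refinement of $\alpha$ ($\beta\le\alpha$) if $\beta$ is obtained by replacing each cycle $\alpha_i$ of $\alpha$ by a permutation $\beta_i$ of the same $n_i$ points with $z(\beta_i)+z(\beta_i^{-1}\alpha_i)=n_i+1$. The Whitney polynomial is $$R(\sigma,\alpha;u,v)=\sum_{\beta\leq\alpha}u^{\kappa(\sigma,\beta)-\kappa(\sigma,\alpha)}\,v^{\kappa(\sigma,\beta)+n-z(\beta)-z(\sigma)}.$$ Paper model. Draw the planar hypermap in the plane, vertices and hyperedges being solid (closed disk-like) areas of paper,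 with the vertex containing $i$ attached to the hyperedge containing $i$ at the point $i$, and the faces being missing; cycles of $\sigma$ are listed counterclockwise and cycles of $\alpha$ clockwise. On the outline of the hyperedge $(i_1,\ldots,i_k)$ mark, in clockwise cyclic order, points $i_1^-,i_1^+,\ldots,i_k^-,i_k^+$, with $i^-$ immediately preceding and $i^+$ immediately succeeding the place where the hyperedge is attached to the vertex at $i$. The outline arcs join $i^+$ to $\sigma(i)^-$ (running along hyperedges and a vertex) and $i^+$ to $\alpha(i)^-$ (running along a hyperedge). Cutting procedure. An outcome is obtained by making a (possibly empty) set of cuts, subject to the rules: (R1) each cut is a simple curve connecting a point $i^+$ with a point $j^-$ inside a hyperedge (cuts into vertex areas are not allowed), where the pair is nontrivial, i.e. $j\ne\alpha(i)$; (R2) each point $i^+$ and each point $j^-$ is used at most once; (R3) the points not used in the cuts come in pairs $(i^+,\alpha(i)^-)$; (R4) a new cut cannot cut into the cut-line of a previous cut. Outcomes are distinguished only by the set of pairs $(i^+,j^-)$ joined by cuts. Cuts replace the hyperedge permutation $\alpha$ with the refinement $\beta$ of $\alpha$ given by $\beta(i)=j$ if $i^+$ and $j^-$ are joined by a cut and $\beta(i)=\alpha(i)$ otherwise; after the cuts the pieces of paper are the connected components of $(\sigma,\beta)$ and the closed curves forming the outlines of the pieces correspond to the cycles of $\beta^{-1}\sigma$. The unbounded face is thought of as the ocean: each connected component (piece of paper) has exactly one wet coastline, namely its outer outline curve; every other outline curve bounds a dry face. *)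

theory Defs
  imports
    "HOL-Combinatorics.Orbits"
    "HOL-Algebra.Sym_Groups"
    "HOL-Complex_Analysis.Complex_Analysis"
begin

section \<open>Hypermaps and the Whitney polynomial\<close>

text \<open>
  Permutations are functions \<^term>\<open>p\<close> with \<^prop>\<open>p permutes S\<close>; on \<^term>\<open>S\<close> the \<^const>\<open>orbit\<close> of
  a point is its cycle, so that fixed points are cycles of length one.
\<close>

definition cycles :: "nat set \<Rightarrow> (nat \<Rightarrow> nat) \<Rightarrow> nat set set" where
  "cycles S p = orbit p ` S"

definition num_cycles :: "nat set \<Rightarrow> (nat \<Rightarrow> nat) \<Rightarrow> nat" where
  "num_cycles S p = card (cycles S p)"

definition components :: "nat \<Rightarrow> (nat \<Rightarrow> nat) \<Rightarrow> (nat \<Rightarrow> nat) \<Rightarrow> nat set set" where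
  "components n \<sigma> \<alpha> = (\<lambda>i. {g i | g. g \<in> generate (sym_group n) {\<sigma>, \<alpha>}}) ` {1..n}"

definition num_components :: "nat \<Rightarrow> (nat \<Rightarrow> nat) \<Rightarrow> (nat \<Rightarrow> nat) \<Rightarrow> nat" where
  "num_components n \<sigma> \<alpha> = card (components n \<sigma> \<alpha>)"

definition hypermap :: "nat \<Rightarrow> (nat \<Rightarrow> nat) \<Rightarrow> (nat \<Rightarrow> nat) \<Rightarrow> bool" where
  "hypermap n \<sigma> \<alpha> \<longleftrightarrow>
     \<sigma> permutes {1..n} \<and> \<alpha> permutes {1..n} \<and> num_components n \<sigma> \<alpha> = 1"

text \<open>The solution \<open>g\<close> of \<open>n + 2 - 2 g = z(\<sigma>) + z(\<alpha>) + z(\<alpha>\<inverse>\<sigma>)\<close>.\<close>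

definition genus :: "nat \<Rightarrow> (nat \<Rightarrow> nat) \<Rightarrow> (nat \<Rightarrow> nat) \<Rightarrow> real" where
  "genus n \<sigma> \<alpha> =
     (real n + 2 - real (num_cycles {1..n} \<sigma>) - real (num_cycles {1..n} \<alpha>)
        - real (num_cycles {1..n} (inv' \<alpha> \<circ> \<sigma>))) / 2"

definition planar_hypermap :: "nat \<Rightarrow> (nat \<Rightarrow> nat) \<Rightarrow> (nat \<Rightarrow> nat) \<Rightarrow> bool" where
  "planar_hypermap n \<sigma> \<alpha> \<longleftrightarrow> hypermap n \<sigma> \<alpha> \<and> genus n \<sigma> \<alpha> = 0"

definition refinement :: "nat \<Rightarrow> (nat \<Rightarrow> nat) \<Rightarrow> (nat \<Rightarrow> nat) \<Rightarrow> bool" where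
  "refinement n \<beta> \<alpha> \<longleftrightarrow>
     \<beta> permutes {1..n} \<and>
     (\<forall>c \<in> cycles {1..n} \<alpha>.
        perm_restrict \<beta> c permutes c \<and>
        num_cycles c (perm_restrict \<beta> c)
          + num_cycles c (inv' (perm_restrict \<beta> c) \<circ> perm_restrict \<alpha> c) = card c + 1)"

text \<open>
  Neither subtraction in the exponents is truncated: passing to a refinement cannot decrease the
  number of components, and \<open>z(\<beta>) + z(\<sigma>) \<le> n + \<kappa>(\<sigma>, \<beta>)\<close> because the bipartite graph with \<open>n\<close> edges
  joining the cycles of \<open>\<sigma>\<close> to those of \<open>\<beta>\<close> through common points has \<open>\<kappa>(\<sigma>, \<beta>)\<close> components.
\<close>

definition whitney ::
  "nat \<Rightarrow> (nat \<Rightarrow> nat) \<Rightarrow> (nat \<Rightarrow> nat) \<Rightarrow> 'a::comm_ring_1 \<Rightarrow> 'a \<Rightarrow> 'a" where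
  "whitney n \<sigma> \<alpha> u v =
     (\<Sum>\<beta> | refinement n \<beta> \<alpha>.
        u ^ (num_components n \<sigma> \<beta> - num_components n \<sigma> \<alpha>) *
        v ^ (num_components n \<sigma> \<beta> + n - num_cycles {1..n} \<beta> - num_cycles {1..n} \<sigma>))"


section \<open>The paper model\<close>

text \<open>
  A closed disk-like area of the plane is the image of \<^term>\<open>cball (0::complex) 1\<close> under a
  parametrization that preserves orientation, so that decreasing angles run clockwise along the
  outline of the area.
\<close>

definition disk_param :: "(complex \<Rightarrow> complex) \<Rightarrow> bool" where
  "disk_param \<phi> \<longleftrightarrow>
     continuous_on (cball 0 1) \<phi> \<and> inj_on \<phi> (cball 0 1) \<and>
     (\<forall>z \<in> ball 0 1. winding_number (\<phi> \<circ> circlepath 0 1) (\<phi> z) = 1)"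

definition area :: "(complex \<Rightarrow> complex) \<Rightarrow> complex set" where
  "area \<phi> = \<phi> ` cball 0 1"

text \<open>The listed points are distinct and lie on the outline in this clockwise cyclic order.\<close>

definition clockwise :: "(complex \<Rightarrow> complex) \<Rightarrow> complex list \<Rightarrow> bool" where
  "clockwise \<phi> xs \<longleftrightarrow>
     (\<exists>t :: nat \<Rightarrow> real.
        (\<forall>k < length xs. xs ! k = \<phi> (cis (t k))) \<and>
        (\<forall>j k. j < k \<and> k < length xs \<longrightarrow> t k < t j \<and> t j < t k + 2 * pi))"

definition counterclockwise :: "(complex \<Rightarrow> complex) \<Rightarrow> complex list \<Rightarrow> bool" where
  "counterclockwise \<phi> xs \<longleftrightarrow> clockwise \<phi> (rev xs)"

text \<open>\<open>Minus i\<close> and \<open>Plus i\<close> stand for the points \<open>i\<^sup>-\<close> and \<open>i\<^sup>+\<close>.\<close>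

datatype mark = Minus nat | Plus nat

record paper =
  vertex_param :: "nat set \<Rightarrow> complex \<Rightarrow> complex"
  hyperedge_param :: "nat set \<Rightarrow> complex \<Rightarrow> complex"
  attach :: "nat \<Rightarrow> complex"
  position :: "mark \<Rightarrow> complex"

text \<open>
  The areas of the vertices and hyperedges are indexed by the cycles of \<open>\<sigma>\<close> and \<open>\<alpha>\<close>.
  \<^term>\<open>support p i\<close> is the list \<open>[i, p i, p (p i), \<dots>]\<close> running once through the cycle of \<open>i\<close>.
\<close>

definition paper_model :: "nat \<Rightarrow> (nat \<Rightarrow> nat) \<Rightarrow> (nat \<Rightarrow> nat) \<Rightarrow> paper \<Rightarrow> bool" where
  "paper_model n \<sigma> \<alpha> M \<longleftrightarrow>
     (\<forall>c \<in> cycles {1..n} \<sigma>. disk_param (vertex_param M c)) \<and>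
     (\<forall>c \<in> cycles {1..n} \<alpha>. disk_param (hyperedge_param M c)) \<and>
     (\<forall>c \<in> cycles {1..n} \<sigma>. \<forall>d \<in> cycles {1..n} \<sigma>. c \<noteq> d \<longrightarrow>
        area (vertex_param M c) \<inter> area (vertex_param M d) = {}) \<and>
     (\<forall>c \<in> cycles {1..n} \<alpha>. \<forall>d \<in> cycles {1..n} \<alpha>. c \<noteq> d \<longrightarrow>
        area (hyperedge_param M c) \<inter> area (hyperedge_param M d) = {}) \<and>
     (\<forall>c \<in> cycles {1..n} \<sigma>. \<forall>d \<in> cycles {1..n} \<alpha>.
        area (vertex_param M c) \<inter> area (hyperedge_param M d) = attach M ` (c \<inter> d)) \<and>
     (\<forall>i \<in> {1..n}.
        counterclockwise (vertex_param M (orbit \<sigma> i)) (map (attach M) (support \<sigma> i))) \<and>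
     (\<forall>i \<in> {1..n}.
        clockwise (hyperedge_param M (orbit \<alpha> i))
          (concat (map (\<lambda>j. [position M (Minus j), attach M j, position M (Plus j)])
            (support \<alpha> i))))"


section \<open>The cutting procedure\<close>

definition cut_curve ::
  "nat \<Rightarrow> (nat \<Rightarrow> nat) \<Rightarrow> paper \<Rightarrow> nat \<Rightarrow> nat \<Rightarrow> (real \<Rightarrow> complex) \<Rightarrow> bool" where
  "cut_curve n \<alpha> M i j \<gamma> \<longleftrightarrow>
     arc \<gamma> \<and> pathstart \<gamma> = position M (Plus i) \<and> pathfinish \<gamma> = position M (Minus j) \<and>
     (\<exists>c \<in> cycles {1..n} \<alpha>.
        i \<in> c \<and> j \<in> c \<and> \<gamma> ` {0<..<1} \<subseteq> hyperedge_param M c ` ball 0 1)"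

text \<open>
  An outcome is the set of pairs \<open>(i, j)\<close> for which \<open>i\<^sup>+\<close> and \<open>j\<^sup>-\<close> are joined by a cut.
  The conjuncts are the rules (R1) -- (R4), where \<open>\<gamma> (i, j)\<close> is the curve of the cut; since the
  endpoints of different cuts differ, (R4) says that the curves are disjoint.
\<close>

definition outcomes :: "nat \<Rightarrow> (nat \<Rightarrow> nat) \<Rightarrow> paper \<Rightarrow> (nat \<times> nat) set set" where
  "outcomes n \<alpha> M =
     {C. C \<subseteq> {1..n} \<times> {1..n} \<and>
        (\<exists>\<gamma>. (\<forall>(i, j) \<in> C. j \<noteq> \<alpha> i \<and> cut_curve n \<alpha> M i j (\<gamma> (i, j))) \<and>
             (\<forall>(i, j) \<in> C. \<forall>(i', j') \<in> C. i = i' \<longleftrightarrow> j = j') \<and>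
             (\<forall>i \<in> {1..n}. i \<notin> fst ` C \<longleftrightarrow> \<alpha> i \<notin> snd ` C) \<and>
             (\<forall>p \<in> C. \<forall>q \<in> C. p \<noteq> q \<longrightarrow> path_image (\<gamma> p) \<inter> path_image (\<gamma> q) = {}))}"

definition cut_perm :: "(nat \<Rightarrow> nat) \<Rightarrow> (nat \<times> nat) set \<Rightarrow> nat \<Rightarrow> nat" where
  "cut_perm \<alpha> C i = (if \<exists>j. (i, j) \<in> C then THE j. (i, j) \<in> C else \<alpha> i)"

definition pieces ::
  "nat \<Rightarrow> (nat \<Rightarrow> nat) \<Rightarrow> (nat \<Rightarrow> nat) \<Rightarrow> (nat \<times> nat) set \<Rightarrow> nat set set" where
  "pieces n \<sigma> \<alpha> C = components n \<sigma> (cut_perm \<alpha> C)"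

text \<open>
  An outline curve of a piece of paper is represented by the set of marked points it runs through.
  It alternates between the outline arcs from \<open>i\<^sup>+\<close> to \<open>\<sigma>(i)\<^sup>-\<close> and steps that follow a cut or,
  at points not used by a cut, the outline arc from \<open>i\<^sup>+\<close> to \<open>\<alpha>(i)\<^sup>-\<close>.
\<close>

definition outline_steps ::
  "nat \<Rightarrow> (nat \<Rightarrow> nat) \<Rightarrow> (nat \<Rightarrow> nat) \<Rightarrow> (nat \<times> nat) set \<Rightarrow> (mark \<times> mark) set" where
  "outline_steps n \<sigma> \<alpha> C =
     {(Plus i, Minus (\<sigma> i)) | i. i \<in> {1..n}} \<union>
     {(Plus i, Minus j) | i j. (i, j) \<in> C} \<union>
     {(Plus i, Minus (\<alpha> i)) | i. i \<in> {1..n} \<and> i \<notin> fst ` C}"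

definition outlines ::
  "nat \<Rightarrow> (nat \<Rightarrow> nat) \<Rightarrow> (nat \<Rightarrow> nat) \<Rightarrow> (nat \<times> nat) set \<Rightarrow> mark set set" where
  "outlines n \<sigma> \<alpha> C =
     (\<lambda>m. (outline_steps n \<sigma> \<alpha> C \<union> (outline_steps n \<sigma> \<alpha> C)\<inverse>)\<^sup>* `` {m})
       ` (Minus ` {1..n} \<union> Plus ` {1..n})"

definition bounds :: "mark set \<Rightarrow> nat set \<Rightarrow> bool" where
  "bounds L K \<longleftrightarrow> L \<subseteq> Minus ` K \<union> Plus ` K"

text \<open>
  Which of its outline curves is the outer one of a piece depends on the drawing. It is given
  by a function \<open>outer\<close> that assigns to every piece of every outcome one of the outline curves of
  this piece.
\<close>

definition outer_outlines ::
  "nat \<Rightarrow> (nat \<Rightarrow> nat) \<Rightarrow> (nat \<Rightarrow> nat) \<Rightarrow> paper \<Rightarrow>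
     ((nat \<times> nat) set \<Rightarrow> nat set \<Rightarrow> mark set) \<Rightarrow> bool" where
  "outer_outlines n \<sigma> \<alpha> M outer \<longleftrightarrow>
     (\<forall>C \<in> outcomes n \<alpha> M. \<forall>K \<in> pieces n \<sigma> \<alpha> C.
        outer C K \<in> outlines n \<sigma> \<alpha> C \<and> bounds (outer C K) K)"

definition wet_coastlines ::
  "nat \<Rightarrow> (nat \<Rightarrow> nat) \<Rightarrow> (nat \<Rightarrow> nat) \<Rightarrow>
     ((nat \<times> nat) set \<Rightarrow> nat set \<Rightarrow> mark set) \<Rightarrow> (nat \<times> nat) set \<Rightarrow> mark set set" where
  "wet_coastlines n \<sigma> \<alpha> outer C = outer C ` pieces n \<sigma> \<alpha> C"

text \<open>A dry face is represented by the outline curve that bounds it.\<close>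

definition dry_faces ::
  "nat \<Rightarrow> (nat \<Rightarrow> nat) \<Rightarrow> (nat \<Rightarrow> nat) \<Rightarrow>
     ((nat \<times> nat) set \<Rightarrow> nat set \<Rightarrow> mark set) \<Rightarrow> (nat \<times> nat) set \<Rightarrow> mark set set" where
  "dry_faces n \<sigma> \<alpha> outer C = outlines n \<sigma> \<alpha> C - wet_coastlines n \<sigma> \<alpha> outer C"

end

theory Submission
  imports Defs
begin

text \<open>
  An outcome \<open>C\<close> is determined by the permutation \<open>\<beta>\<close> into which it turns \<open>\<alpha>\<close>. By Fashoda's theorem,
  disjoint curves inside a disk cannot have interlaced endpoints, and conversely straight chords
  whose endpoints are not interlaced are disjoint. So outcomes correspond to the permutations \<open>\<beta>\<close>
  that are noncrossing on each cycle of \<open>\<alpha>\<close>. Being noncrossing on a cycle of length \<open>k\<close> means that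
  the bipartite graph with the \<open>k\<close> points as edges, joining cycles of \<open>\<beta>\<close> to cycles of \<open>\<beta>\<inverse>\<alpha>\<close>, is a
  tree, which amounts to \<open>z(\<beta>) + z(\<beta>\<inverse>\<alpha>) = k + 1\<close>, so these \<open>\<beta>\<close> are the refinements of \<open>\<alpha>\<close>.

  A refinement is reached from \<open>\<alpha>\<close> by multiplying with transpositions each of which splits a cycle,
  and such a step does not increase the genus (summed over components). Hence \<open>(\<sigma>, \<beta>)\<close> has genus \<open>0\<close>,
  and Euler's formula expresses the number of outlines, \<open>z(\<beta>\<inverse>\<sigma>)\<close>, by the exponents in the Whitney
  polynomial.
\<close>

section \<open>Connected classes of a relation\<close>

text \<open>The genus inequality \<open>defect_nonneg\<close> serves two different pairs. For
  \<open>\<sigma>\<close> and \<open>\<beta>\<close> it closes the count of outlines. For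
  \<open>\<beta>\<close> and \<open>\<alpha>\<close>, both restricted to one cycle of
  \<open>\<alpha>\<close> with \<open>k\<close> points, it gives z(\<beta>) +
  z(\<beta>^{-1}\<alpha>) \<le> k + 1, and in the case of equality it shows that one step from
  \<open>\<alpha>\<close> towards \<open>\<beta>\<close> breaks the cycle into two segments that
  \<open>\<beta>\<close> preserves; this is how a counting equation excludes crossings. The opposite
  bound comes from the bipartite graph: if nothing crosses, every edge is a bridge, and a forest
  with \<open>k\<close> edges has at least k + 1 vertices. Cyclic orders are avoided by indexing the
  points of a hyperedge from the target x = \<beta>(i) of the cut under consideration. If i has
  index m, this cut cuts off the initial segment 0, ..., m, and crossing it becomes a comparison of
  indices.\<close>

definition conn :: "('a \<times> 'a) set \<Rightarrow> ('a \<times> 'a) set" where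
  "conn R = (R \<union> R\<inverse>)\<^sup>*"

text \<open>Cycles, components and outlines are all counted by this one function. The counting rests
  on the fact that one further edge lowers it by one or leaves it unchanged.\<close>

definition num_classes :: "'a set \<Rightarrow> ('a \<times> 'a) set \<Rightarrow> nat" where
  "num_classes S R = card ((\<lambda>x. conn R `` {x}) ` S)"

lemma conn_refl [simp, intro]: "(x, x) \<in> conn R"
  by (simp add: conn_def)

lemma conn_sym: "(x, y) \<in> conn R \<Longrightarrow> (y, x) \<in> conn R"
  unfolding conn_def by (metis converse_Un converse_converse rtrancl_converseI sup_commute)

lemma conn_trans: "(x, y) \<in> conn R \<Longrightarrow> (y, z) \<in> conn R \<Longrightarrow> (x, z) \<in> conn R"
  unfolding conn_def by (rule rtrancl_trans)

lemma conn_edge: "(x, y) \<in> R \<Longrightarrow> (x, y) \<in> conn R"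
  unfolding conn_def by blast

lemma conn_least:
  assumes "R \<subseteq> conn R'" shows "conn R \<subseteq> conn R'"
proof -
  have "R \<union> R\<inverse> \<subseteq> conn R'" using assms by (auto intro: conn_sym)
  then have "(R \<union> R\<inverse>)\<^sup>* \<subseteq> (conn R')\<^sup>*" by (rule rtrancl_mono)
  then show ?thesis by (simp add: conn_def)
qed

lemma conn_mono: "R \<subseteq> R' \<Longrightarrow> conn R \<subseteq> conn R'"
  by (rule conn_least) (auto intro: conn_edge)

lemma conn_class_eq_iff: "conn R `` {x} = conn R `` {y} \<longleftrightarrow> (x, y) \<in> conn R"
proof
  show "(x, y) \<in> conn R" if "conn R `` {x} = conn R `` {y}"
    using that conn_refl[of y R] by blast
  show "conn R `` {x} = conn R `` {y}" if "(x, y) \<in> conn R"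
    using that conn_sym[OF that] by (auto intro: conn_trans)
qed

text \<open>The way to refute connectedness: exhibit a set \<open>W\<close> that no edge enters or
  leaves.\<close>

lemma conn_closed:
  assumes "(x, y) \<in> conn R" and "\<And>a b. (a, b) \<in> R \<Longrightarrow> a \<in> W \<longleftrightarrow> b \<in> W"
  shows "x \<in> W \<longleftrightarrow> y \<in> W"
  using assms(1) unfolding conn_def by (induction rule: rtrancl_induct) (auto simp: assms(2))

lemma conn_image:
  assumes "(x, y) \<in> conn R" and edge: "\<And>a b. (a, b) \<in> R \<Longrightarrow> (h a, h b) \<in> conn R'"
  shows "(h x, h y) \<in> conn R'"
proof -
  have "x \<in> {z. (h x, h z) \<in> conn R'} \<longleftrightarrow> y \<in> {z. (h x, h z) \<in> conn R'}"
  proof (rule conn_closed[OF assms(1)])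
    fix a b assume "(a, b) \<in> R"
    then have "(h a, h b) \<in> conn R'" "(h b, h a) \<in> conn R'" using edge conn_sym by metis+
    then show "a \<in> {z. (h x, h z) \<in> conn R'} \<longleftrightarrow> b \<in> {z. (h x, h z) \<in> conn R'}"
      using conn_trans by (metis mem_Collect_eq)
  qed
  then show ?thesis by simp
qed

lemma num_classes_cong: "conn R = conn R' \<Longrightarrow> num_classes S R = num_classes S R'"
  by (simp add: num_classes_def)

lemma num_classes_insert_connected:
  assumes "(a, b) \<in> conn R" shows "num_classes S (insert (a, b) R) = num_classes S R"
  by (rule num_classes_cong, rule antisym; rule conn_least) (use assms in \<open>auto intro: conn_edge\<close>)

text \<open>A path needs the new edge at most once, in one of its two directions.\<close>

lemma conn_insert:
  "(x, y) \<in> conn (insert (a, b) R) \<longleftrightarrow>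
     (x, y) \<in> conn R \<or> (x, a) \<in> conn R \<and> (b, y) \<in> conn R \<or> (x, b) \<in> conn R \<and> (a, y) \<in> conn R"
    (is "?L \<longleftrightarrow> ?Q y")
proof
  assume ?L
  then show "?Q y" unfolding conn_def[of "insert (a, b) R"]
  proof (induction rule: rtrancl_induct)
    case (step y z)
    then consider "(y, z) \<in> conn R" | "y = a" "z = b" | "y = b" "z = a"
      by (auto intro: conn_edge conn_sym)
    then show ?case
      by cases (use step.IH in \<open>blast intro: conn_trans conn_sym\<close>)+
  qed simp
next
  have "conn R \<subseteq> conn (insert (a, b) R)" by (rule conn_mono) blast
  moreover have "(a, b) \<in> conn (insert (a, b) R)" by (rule conn_edge) simp
  ultimately show "?Q y \<Longrightarrow> ?L" by (meson conn_sym conn_trans subsetD)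
qed

lemma num_classes_insert_unconnected:
  assumes S: "finite S" "a \<in> S" "b \<in> S" and ab: "(a, b) \<notin> conn R"
  shows "num_classes S R = num_classes S (insert (a, b) R) + 1"
proof -
  let ?R = "insert (a, b) R"
  let ?K = "\<lambda>x. conn R `` {x}" and ?K' = "\<lambda>x. conn ?R `` {x}"
  \<comment> \<open>The old class of \<open>b\<close> is dropped because the old class of
    \<open>a\<close> already represents the merged class.\<close>
  have "bij_betw (\<lambda>X. conn ?R `` X) (?K ` S - {?K b}) (?K' ` S)"
  proof (rule bij_betwI')
    have KK: "conn ?R `` (?K x) = ?K' x" for x
      by (auto simp: conn_insert intro: conn_trans conn_sym)
    show "conn ?R `` X = conn ?R `` Y \<longleftrightarrow> X = Y"
      if XY: "X \<in> ?K ` S - {?K b}" "Y \<in> ?K ` S - {?K b}" for X Y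
    proof
      obtain x y where "X = ?K x" "Y = ?K y" using XY by blast
      moreover assume "conn ?R `` X = conn ?R `` Y"
      ultimately have "(x, y) \<in> conn ?R" "(x, b) \<notin> conn R" "(y, b) \<notin> conn R"
        using XY by (simp_all add: KK conn_class_eq_iff)
      then have "(x, y) \<in> conn R" by (auto simp: conn_insert dest: conn_sym)
      then show "X = Y" by (simp add: \<open>X = _\<close> \<open>Y = _\<close> conn_class_eq_iff)
    qed simp
    show "conn ?R `` X \<in> ?K' ` S" if "X \<in> ?K ` S - {?K b}" for X
      using that KK by auto
    show "\<exists>X \<in> ?K ` S - {?K b}. Y = conn ?R `` X" if Y: "Y \<in> ?K' ` S" for Y
    proof -
      obtain x where x: "x \<in> S" "Y = ?K' x" using Y by blast
      show ?thesis
      proof (cases "(x, b) \<in> conn R")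
        case True
        then have "(x, a) \<in> conn ?R" by (auto simp: conn_insert)
        then have "?K' x = ?K' a" by (simp only: conn_class_eq_iff)
        then have "Y = conn ?R `` (?K a)" using x KK by simp
        moreover have "?K a \<in> ?K ` S - {?K b}" using S ab by (auto simp: conn_class_eq_iff)
        ultimately show ?thesis by blast
      next
        case False
        then have "?K x \<in> ?K ` S - {?K b}" using x by (auto simp: conn_class_eq_iff)
        then show ?thesis using x KK by metis
      qed
    qed
  qed
  then have "card (?K ` S - {?K b}) = card (?K' ` S)" by (rule bij_betw_same_card)
  moreover have "card (?K ` S) = card (?K ` S - {?K b}) + 1"
    using S by (metis Suc_eq_plus1 card_Suc_Diff1 finite_imageI image_eqI)
  ultimately show ?thesis unfolding num_classes_def by simp
qed

lemma num_classes_insert_le: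
  assumes "finite S" "a \<in> S" "b \<in> S"
  shows "num_classes S (insert (a, b) R) \<le> num_classes S R"
    and "num_classes S R \<le> num_classes S (insert (a, b) R) + 1"
  using num_classes_insert_connected num_classes_insert_unconnected assms
  by (metis Suc_eq_plus1 le_Suc_eq order_refl)+

lemma num_classes_pos: "finite S \<Longrightarrow> S \<noteq> {} \<Longrightarrow> num_classes S R > 0"
  unfolding num_classes_def by (simp add: card_gt_0_iff)

section \<open>Cycles of a permutation as connected classes\<close>

definition edges :: "'a set \<Rightarrow> ('a \<Rightarrow> 'a) \<Rightarrow> ('a \<times> 'a) set" where
  "edges S p = (\<lambda>x. (x, p x)) ` S"

definition cyc :: "'a set \<Rightarrow> ('a \<Rightarrow> 'a) \<Rightarrow> nat" where
  "cyc S p = num_classes S (edges S p)"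

lemma edgesI: "x \<in> S \<Longrightarrow> (x, p x) \<in> edges S p"
  by (auto simp: edges_def)

lemma edges_iff: "(x, y) \<in> edges S p \<longleftrightarrow> x \<in> S \<and> y = p x"
  by (auto simp: edges_def)

lemma conn_edges_funpow:
  assumes "p permutes S" "x \<in> S" shows "(x, (p ^^ k) x) \<in> conn (edges S p)"
proof (induction k)
  case (Suc k)
  have "(p ^^ k) x \<in> S" using assms by (simp add: permutes_in_funpow_image)
  then show ?case using Suc by (auto intro: conn_trans conn_edge edgesI)
qed simp

text \<open>\<open>orbit\<close> iterates forwards only, while \<open>conn\<close> also follows
  edges backwards. On a finite set every point returns to itself under a permutation, so both reach
  the same points.\<close>

lemma orbit_eq_conn:
  assumes "finite S" "p permutes S" "x \<in> S"
  shows "orbit p x = conn (edges S p) `` {x}"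
proof
  show "orbit p x \<subseteq> conn (edges S p) `` {x}"
    using conn_edges_funpow[OF assms(2,3)] by (auto simp: orbit_altdef)
  have "permutation p" using assms permutation_permutes by blast
  show "conn (edges S p) `` {x} \<subseteq> orbit p x"
  proof
    fix y assume "y \<in> conn (edges S p) `` {x}"
    then have "(x, y) \<in> conn (edges S p)" by simp
    moreover have "a \<in> orbit p x \<longleftrightarrow> b \<in> orbit p x" if "(a, b) \<in> edges S p" for a b
      using that \<open>permutation p\<close>
      by (metis edges_iff orbit.step orbit_swap orbit_trans permutation_self_in_orbit orbit.base)
    ultimately show "y \<in> orbit p x"
      using conn_closed[of x y "edges S p" "orbit p x"] permutation_self_in_orbit[OF \<open>permutation p\<close>]
      by blast
  qed
qed

lemma num_cycles_eq_cyc: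
  assumes "finite S" "p permutes S" shows "num_cycles S p = cyc S p"
  unfolding num_cycles_def cycles_def cyc_def num_classes_def
  using orbit_eq_conn[OF assms] by (metis (no_types, lifting) image_cong)

section \<open>Genus and transpositions\<close>

lemma edges_inv:
  assumes "p permutes S" shows "edges S (inv' p) = (edges S p)\<inverse>"
  using assms by (auto simp: edges_iff permutes_inverses permutes_in_image permutes_inv)

lemma cyc_inv:
  assumes "p permutes S" shows "cyc S (inv' p) = cyc S p"
  unfolding cyc_def by (rule num_classes_cong) (simp add: conn_def edges_inv[OF assms] sup_commute)

lemma num_classes_empty: "num_classes S {} = card S"
proof -
  have "(\<lambda>x. conn {} `` {x}) ` S = (\<lambda>x. {x}) ` S" by (simp add: conn_def)
  then show ?thesis unfolding num_classes_def by (metis card_image inj_singleton inj_on_subset subset_UNIV)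
qed

lemma num_classes_antimono:
  assumes "finite S" "R \<subseteq> conn R'" shows "num_classes S R' \<le> num_classes S R"
proof -
  have "conn R' `` (conn R `` {x}) = conn R' `` {x}" for x
    using conn_least[OF assms(2)] by (auto intro: conn_trans)
  then have "(\<lambda>x. conn R' `` {x}) ` S = (``) (conn R') ` (\<lambda>x. conn R `` {x}) ` S"
    by (simp add: image_image)
  then show ?thesis unfolding num_classes_def using assms(1) by (metis card_image_le finite_imageI)
qed

lemma num_classes_Un_id: "num_classes S (R \<union> edges S id) = num_classes S R"
proof (rule num_classes_cong, rule antisym; rule conn_least)
qed (auto simp: edges_def intro: conn_edge)

lemma cyc_id: "cyc S id = card S"
  using num_classes_Un_id[of S "{}"] by (simp add: cyc_def num_classes_empty)

lemma conn_in:
  assumes "(x, y) \<in> conn R" "R \<subseteq> S \<times> S" "x \<in> S" shows "y \<in> S"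
  using conn_closed[OF assms(1), of S] assms by blast

lemma edges_subset: "p permutes S \<Longrightarrow> edges S p \<subseteq> S \<times> S"
  by (auto simp: edges_def permutes_in_image)

section \<open>The effect of a transposition on cycles\<close>

lemma permutes_comp_transpose:
  "p permutes S \<Longrightarrow> i \<in> S \<Longrightarrow> j \<in> S \<Longrightarrow> p \<circ> Transposition.transpose i j permutes S"
  by (intro permutes_compose permutes_swap_id)

text \<open>The product sends \<open>i\<close> to \<open>p j\<close> and then follows
  \<open>p\<close> around the old cycle of \<open>j\<close>, which avoids \<open>i\<close>, until it
  arrives at \<open>j\<close>. The induction over the orbit is run under the assumption that
  \<open>j\<close> is never reached, which keeps both exceptional points away.\<close>

lemma merge_cycles:
  assumes S: "finite S" and p: "p permutes S" and ij: "i \<in> S" "j \<in> S"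
    and nc: "(i, j) \<notin> conn (edges S p)"
  shows "(i, j) \<in> conn (edges S (p \<circ> Transposition.transpose i j))"
proof (rule ccontr)
  let ?q = "p \<circ> Transposition.transpose i j"
  assume c: "(i, j) \<notin> conn (edges S ?q)"
  have W: "(i, y) \<in> conn (edges S ?q)" if "y \<in> orbit p j" for y
    using that
  proof induction
    case base
    have "(i, p j) \<in> edges S ?q" using ij by (simp add: edges_iff)
    then show ?case by (rule conn_edge)
  next
    case (step y)
    have "y \<noteq> j" using step c by blast
    moreover have "(j, y) \<in> conn (edges S p)" using step orbit_eq_conn[OF S p] ij by blast
    then have "y \<noteq> i" "y \<in> S" using nc conn_in[OF _ edges_subset[OF p]] ij by (blast intro: conn_sym)+
    ultimately have "(y, p y) \<in> edges S ?q" by (auto simp: edges_iff Transposition.transpose_def)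
    then show ?case using step by (blast intro: conn_trans conn_edge)
  qed
  have "permutation p" using S p permutation_permutes by metis
  then have "j \<in> orbit p j" by (rule permutation_self_in_orbit)
  then show False using W c by blast
qed

text \<open>The product sends \<open>i\<close> to \<open>p j\<close> and follows \<open>p\<close>
  until \<open>i\<close> is reached again. The cycle closes there and has not passed through
  \<open>j\<close>.\<close>

lemma split_cycle:
  assumes S: "finite S" and p: "p permutes S" and ij: "i \<in> S" "j \<in> S" "i \<noteq> j"
    and nc: "(i, j) \<in> conn (edges S p)"
  shows "(i, j) \<notin> conn (edges S (p \<circ> Transposition.transpose i j))"
proof
  let ?q = "p \<circ> Transposition.transpose i j"
  assume c: "(i, j) \<in> conn (edges S ?q)"
  have "i \<in> orbit p j" using nc orbit_eq_conn[OF S p] ij by (auto intro: conn_sym)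
  then have ex: "\<exists>k>0. (p ^^ k) j = i" by (auto simp: orbit_altdef)
  define k where "k = (LEAST k. k > 0 \<and> (p ^^ k) j = i)"
  have k: "k > 0" "(p ^^ k) j = i" using LeastI_ex[OF ex] by (auto simp: k_def)
  have min: "(p ^^ l) j \<noteq> i" if "0 < l" "l < k" for l
    using not_less_Least[of l "\<lambda>k. k > 0 \<and> (p ^^ k) j = i"] that by (auto simp: k_def)
  \<comment> \<open>If \<open>j\<close> recurred before step \<open>k\<close>, then \<open>i\<close>
    would have been reached earlier as well, against the choice of \<open>k\<close>.\<close>
  have nj: "(p ^^ l) j \<noteq> j" if "0 < l" "l \<le> k" for l
  proof
    assume l: "(p ^^ l) j = j"
    then have "l < k" using that k ij le_neq_implies_less by metis
    have "(p ^^ (k - l + l)) j = i" using k \<open>l < k\<close> by simp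
    then have "(p ^^ (k - l)) j = i" by (simp only: funpow_add o_apply l)
    then show False using min[of "k - l"] \<open>l < k\<close> that by simp
  qed
  have "y \<in> {(p ^^ l) j | l. 0 < l \<and> l \<le> k}" if "y \<in> orbit ?q i" for y
    using that
  proof induction
    case base
    have "?q i = (p ^^ 1) j" by simp
    then show ?case using k by (metis (mono_tags, lifting) One_nat_def Suc_leI mem_Collect_eq zero_less_one)
  next
    case (step y)
    then obtain l where l: "0 < l" "l \<le> k" "y = (p ^^ l) j" by blast
    show ?case
    proof (cases "l = k")
      case True
      then have "?q y = (p ^^ 1) j" using l k by simp
      then show ?thesis using k by (metis (mono_tags, lifting) One_nat_def Suc_leI mem_Collect_eq zero_less_one)
    next
      case False
      then have "?q y = (p ^^ Suc l) j" using l min[of l] nj[of l] by (simp add: Transposition.transpose_def)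
      moreover have "Suc l \<le> k" using l False by simp
      ultimately show ?thesis by blast
    qed
  qed
  moreover have "j \<in> orbit ?q i"
    using c orbit_eq_conn[OF S permutes_comp_transpose[OF p ij(1,2)] ij(1)] by blast
  ultimately have "\<exists>l. 0 < l \<and> l \<le> k \<and> j = (p ^^ l) j" by blast
  then show False using nj by metis
qed

text \<open>Both maps have the same values, only swapped at \<open>i\<close> and \<open>j\<close>,
  so an edge between \<open>i\<close> and \<open>j\<close> removes the difference. Cycle and
  component counts before and after a transposition are compared through this common enlarged
  graph.\<close>

lemma conn_insert_transpose:
  assumes "i \<in> S" "j \<in> S"
  shows "conn (insert (i, j) (R \<union> edges S (p \<circ> Transposition.transpose i j))) = conn (insert (i, j) (R \<union> edges S p))"
proof -
  have *: "conn (insert (i, j) (R \<union> edges S (p \<circ> Transposition.transpose i j))) \<subseteq> conn (insert (i, j) (R \<union> edges S p))"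
    (is "_ \<subseteq> conn ?R") for p
  proof (rule conn_least)
    have ij: "(i, j) \<in> conn ?R" "(j, i) \<in> conn ?R" by (auto intro: conn_edge conn_sym)
    have p: "(x, p x) \<in> conn ?R" if "x \<in> S" for x using that by (auto intro: conn_edge edgesI)
    have "(x, p (Transposition.transpose i j x)) \<in> conn ?R" if "x \<in> S" for x
      using p[OF that] p[OF assms(1)] p[OF assms(2)] ij by (auto simp: Transposition.transpose_def intro: conn_trans)
    then show "insert (i, j) (R \<union> edges S (p \<circ> Transposition.transpose i j)) \<subseteq> conn ?R"
      using ij by (auto simp: edges_def intro: conn_edge)
  qed
  show ?thesis using *[of p] *[of "p \<circ> Transposition.transpose i j"] by (simp add: o_assoc[symmetric])
qed

lemma cyc_transpose_same:
  assumes S: "finite S" and p: "p permutes S" and ij: "i \<in> S" "j \<in> S" "i \<noteq> j"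
    and c: "(i, j) \<in> conn (edges S p)"
  shows "cyc S (p \<circ> Transposition.transpose i j) = cyc S p + 1"
proof -
  have "num_classes S (insert (i, j) (edges S (p \<circ> Transposition.transpose i j))) = num_classes S (insert (i, j) (edges S p))"
    using conn_insert_transpose[OF ij(1,2), of "{}"] by (intro num_classes_cong) simp
  then show ?thesis unfolding cyc_def
    using num_classes_insert_connected[OF c]
      num_classes_insert_unconnected[OF S ij(1,2) split_cycle[OF S p ij c]] by simp
qed

lemma cyc_transpose_diff:
  assumes S: "finite S" and p: "p permutes S" and ij: "i \<in> S" "j \<in> S"
    and c: "(i, j) \<notin> conn (edges S p)"
  shows "cyc S p = cyc S (p \<circ> Transposition.transpose i j) + 1"
proof -
  have "num_classes S (insert (i, j) (edges S (p \<circ> Transposition.transpose i j))) = num_classes S (insert (i, j) (edges S p))"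
    using conn_insert_transpose[OF ij(1,2), of "{}"] by (intro num_classes_cong) simp
  then show ?thesis unfolding cyc_def
    using num_classes_insert_connected[OF merge_cycles[OF S p ij c]]
      num_classes_insert_unconnected[OF S ij(1,2) c] by simp
qed

text \<open>
  Twice the genus, summed over the components. The faces are counted as cycles of \<open>s\<inverse>a\<close> instead of
  \<open>a\<inverse>s\<close>, so that a transposition multiplied to the right of \<open>a\<close> stays on the right.
\<close>

definition defect :: "'a set \<Rightarrow> ('a \<Rightarrow> 'a) \<Rightarrow> ('a \<Rightarrow> 'a) \<Rightarrow> int" where
  "defect S s a = int (card S) + 2 * int (num_classes S (edges S s \<union> edges S a))
     - int (cyc S s) - int (cyc S a) - int (cyc S (inv' s \<circ> a))"

text \<open>A cycle of \<open>a\<close> splits, so at most one component is gained, while the number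
  of faces changes by one. If a face splits too, the two new cycles pay for the new component with
  its factor 2. If two faces merge, the merged face keeps \<open>i\<close> and \<open>j\<close>
  connected, so no component is gained and the two cycle counts cancel.\<close>

lemma defect_transpose_le:
  assumes S: "finite S" and s: "s permutes S" and a: "a permutes S"
    and ij: "i \<in> S" "j \<in> S" "i \<noteq> j" and c: "(i, j) \<in> conn (edges S a)"
  shows "defect S s (a \<circ> Transposition.transpose i j) \<le> defect S s a"
proof -
  let ?t = "Transposition.transpose i j" and ?f = "inv' s \<circ> a"
  have f: "?f permutes S" using s a by (intro permutes_compose permutes_inv)
  have "conn (edges S a) \<subseteq> conn (edges S s \<union> edges S a)" by (rule conn_mono) blast
  then have "(i, j) \<in> conn (edges S s \<union> edges S a)" using c by blast
  then have k: "num_classes S (insert (i, j) (edges S s \<union> edges S (a \<circ> ?t))) =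
      num_classes S (edges S s \<union> edges S a)"
    using conn_insert_transpose[OF ij(1,2), of "edges S s" a] num_classes_insert_connected
    by (metis num_classes_cong)
  have 1: "cyc S (a \<circ> ?t) = cyc S a + 1" by (rule cyc_transpose_same[OF S a ij c])
  have assoc: "inv' s \<circ> (a \<circ> ?t) = ?f \<circ> ?t" by (simp add: o_assoc)
  show ?thesis
  proof (cases "(i, j) \<in> conn (edges S ?f)")
    case True
    then have "cyc S (?f \<circ> ?t) = cyc S ?f + 1" by (rule cyc_transpose_same[OF S f ij])
    then show ?thesis using 1 k num_classes_insert_le(2)[OF S ij(1,2), of "edges S s \<union> edges S (a \<circ> ?t)"]
      by (simp add: defect_def assoc)
  next
    case False
    then have 2: "cyc S ?f = cyc S (?f \<circ> ?t) + 1" by (rule cyc_transpose_diff[OF S f ij(1,2)])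
    \<comment> \<open>Each step of the face permutation follows an edge of
      \<open>a \<circ> ?t\<close> forwards and an edge of \<open>s\<close> backwards, so a face lies
      inside one component.\<close>
    have "conn (edges S (?f \<circ> ?t)) \<subseteq> conn (edges S s \<union> edges S (a \<circ> ?t))" (is "_ \<subseteq> conn ?R")
    proof (rule conn_least, clarsimp simp: edges_iff)
      fix x assume x: "x \<in> S"
      let ?y = "a (?t x)"
      have "?y \<in> S" using permutes_in_image[OF permutes_comp_transpose[OF a ij(1,2)], of x] x by simp
      then have "inv' s ?y \<in> S" using permutes_in_image[OF permutes_inv[OF s]] by blast
      then have "(inv' s ?y, ?y) \<in> edges S s" using s by (simp add: edges_iff permutes_inverses)
      moreover have "(x, ?y) \<in> edges S (a \<circ> ?t)" using x by (simp add: edges_iff)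
      ultimately show "(x, inv' s ?y) \<in> conn ?R"
        by (meson UnCI conn_edge conn_sym conn_trans)
    qed
    then have "(i, j) \<in> conn ?R" using merge_cycles[OF S f ij(1,2) False] by blast
    note num_classes_insert_connected[OF this, of S]
    then show ?thesis using 1 2 k by (simp add: defect_def assoc)
  qed
qed

section \<open>Moving from one permutation to another by transpositions\<close>

lemma inv_apply_neq:
  assumes "a permutes S" "b permutes S" "i \<in> S" "a i \<noteq> b i"
  shows "inv' a (b i) \<in> S" "inv' a (b i) \<noteq> i" "a (inv' a (b i)) = b i"
proof -
  show "a (inv' a (b i)) = b i" using assms(1) by (simp add: permutes_inverses)
  then show "inv' a (b i) \<noteq> i" using assms(4) by metis
  have "b i \<in> S" using assms(2,3) by (simp add: permutes_in_image)
  then show "inv' a (b i) \<in> S" using permutes_in_image[OF permutes_inv[OF assms(1)]] by blast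
qed

text \<open>With k = a^{-1}(b(i)), the product takes the value \<open>b i\<close> at
  \<open>i\<close>; its only other changed value is at \<open>k\<close>, where \<open>a\<close>
  already differed from \<open>b\<close>. This transposition drives the inductions from
  \<open>a\<close> towards \<open>b\<close>.\<close>

lemma card_diff_transpose:
  assumes S: "finite S" and a: "a permutes S" and b: "b permutes S"
    and i: "i \<in> S" "a i \<noteq> b i"
  shows "card {x \<in> S. (a \<circ> Transposition.transpose i (inv' a (b i))) x \<noteq> b x} < card {x \<in> S. a x \<noteq> b x}"
proof (rule psubset_card_mono)
  let ?k = "inv' a (b i)"
  have k: "?k \<in> S" "?k \<noteq> i" "a ?k = b i" using inv_apply_neq[OF a b i] .
  have "b ?k \<noteq> b i" using k b by (metis permutes_inverses(2))
  then have "{x \<in> S. (a \<circ> Transposition.transpose i ?k) x \<noteq> b x} \<subseteq> {x \<in> S. a x \<noteq> b x} - {i}"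
    using k by (auto simp: Transposition.transpose_def split: if_splits)
  then show "{x \<in> S. (a \<circ> Transposition.transpose i ?k) x \<noteq> b x} \<subset> {x \<in> S. a x \<noteq> b x}"
    using i by blast
qed (use S in simp)

text \<open>The target of the walk is the identity: k = a^{-1}(i) is in the cycle of
  \<open>i\<close>, so each step splits a cycle and cannot increase the defect, which is 0 at the
  end.\<close>

lemma defect_nonneg:
  assumes S: "finite S" and s: "s permutes S" and "a permutes S"
  shows "0 \<le> defect S s a"
  using assms(3)
proof (induction "card {x \<in> S. a x \<noteq> id x}" arbitrary: a rule: less_induct)
  case less
  note a = less.prems
  show ?case
  proof (cases "\<exists>i \<in> S. a i \<noteq> id i")
    case True
    then obtain i where i: "i \<in> S" "a i \<noteq> id i" by blast
    let ?k = "inv' a (id i)"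
    have k: "?k \<in> S" "?k \<noteq> i" "a ?k = id i" using inv_apply_neq[OF a permutes_id i] .
    have "(?k, a ?k) \<in> edges S a" using k by (intro edgesI)
    then have c: "(i, ?k) \<in> conn (edges S a)" using k(3) by (metis conn_edge conn_sym id_apply)
    have "0 \<le> defect S s (a \<circ> Transposition.transpose i ?k)"
      by (rule less.hyps[OF card_diff_transpose[OF S a permutes_id i] permutes_comp_transpose[OF a i(1) k(1)]])
    also have "\<dots> \<le> defect S s a"
      using defect_transpose_le[OF S s a i(1) k(1) k(2)[symmetric] c] .
    finally show ?thesis .
  next
    case False
    then have "a = id" using a by (metis id_apply permutes_not_in ext)
    \<comment> \<open>For the identity the components are the cycles of \<open>s\<close>, and the
      faces are those of its inverse, so everything cancels.\<close>
    then show ?thesis by (simp add: defect_def num_classes_Un_id cyc_id cyc_inv[OF s]) (simp add: cyc_def)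
  qed
qed

text \<open>Every component of the pair contains a cycle of \<open>a\<close>, so this follows from
  nonnegative genus. It is the triangle inequality for the distance that assigns
  \<open>card S - cyc S (inv' p \<circ> q)\<close> to \<open>p\<close> and \<open>q\<close>.
  Equality says that \<open>b\<close> lies on a geodesic from the identity to
  \<open>a\<close>.\<close>

lemma cyc_le:
  assumes S: "finite S" and b: "b permutes S" and a: "a permutes S"
  shows "cyc S b + cyc S (inv' b \<circ> a) \<le> card S + cyc S a"
proof -
  have "num_classes S (edges S b \<union> edges S a) \<le> cyc S a"
    unfolding cyc_def using S by (intro num_classes_antimono) (auto intro: conn_edge)
  then show ?thesis using defect_nonneg[OF S b a] by (simp add: defect_def)
qed

text \<open>Since b^{-1}a maps \<open>k\<close> to \<open>i\<close>, the transposition splits a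
  cycle of b^{-1}a. If it merged two cycles of \<open>a\<close>, then \<open>cyc_le\<close> would
  fail for the product; so it splits a cycle of \<open>a\<close> too, and equality persists.\<close>

lemma geodesic_step:
  assumes S: "finite S" and b: "b permutes S" and a: "a permutes S"
    and eq: "cyc S b + cyc S (inv' b \<circ> a) = card S + cyc S a"
    and i: "i \<in> S" "a i \<noteq> b i"
  defines "k \<equiv> inv' a (b i)"
  shows "(i, k) \<in> conn (edges S a)"
    and "cyc S (inv' b \<circ> (a \<circ> Transposition.transpose i k)) = cyc S (inv' b \<circ> a) + 1"
    and "cyc S (a \<circ> Transposition.transpose i k) = cyc S a + 1"
proof -
  let ?t = "Transposition.transpose i k" and ?f = "inv' b \<circ> a"
  have k: "k \<in> S" "k \<noteq> i" "a k = b i" using inv_apply_neq[OF a b i] unfolding k_def .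
  have f: "?f permutes S" using a b by (intro permutes_compose permutes_inv)
  have "(k, ?f k) \<in> edges S ?f" using k by (intro edgesI)
  moreover have "?f k = i" using k b by (simp add: permutes_inverses)
  ultimately have "(i, k) \<in> conn (edges S ?f)" by (metis conn_edge conn_sym)
  then have 1: "cyc S (?f \<circ> ?t) = cyc S ?f + 1"
    by (rule cyc_transpose_same[OF S f i(1) k(1) k(2)[symmetric]])
  have 2: "cyc S b + cyc S (inv' b \<circ> (a \<circ> ?t)) \<le> card S + cyc S (a \<circ> ?t)"
    by (rule cyc_le[OF S b permutes_comp_transpose[OF a i(1) k(1)]])
  show "cyc S (inv' b \<circ> (a \<circ> ?t)) = cyc S ?f + 1" using 1 by (simp add: o_assoc)
  then show c: "(i, k) \<in> conn (edges S a)"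
    using 2 eq cyc_transpose_diff[OF S a i(1) k(1)] by linarith
  show "cyc S (a \<circ> ?t) = cyc S a + 1"
    using cyc_transpose_same[OF S a i(1) k(1) k(2)[symmetric] c] .
qed

lemma defect_geodesic_le:
  assumes S: "finite S" and s: "s permutes S" and b: "b permutes S" and "a permutes S"
    and "cyc S b + cyc S (inv' b \<circ> a) = card S + cyc S a"
  shows "defect S s b \<le> defect S s a"
  using assms(4,5)
proof (induction "card {x \<in> S. a x \<noteq> b x}" arbitrary: a rule: less_induct)
  case less
  note a = less.prems(1) and eq = less.prems(2)
  show ?case
  proof (cases "\<exists>i \<in> S. a i \<noteq> b i")
    case True
    then obtain i where i: "i \<in> S" "a i \<noteq> b i" by blast
    let ?k = "inv' a (b i)"
    have k: "?k \<in> S" "?k \<noteq> i" "a ?k = b i" using inv_apply_neq[OF a b i] .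
    note step = geodesic_step[OF S b a eq i]
    have "defect S s b \<le> defect S s (a \<circ> Transposition.transpose i ?k)"
      using step(2,3) eq
      by (intro less.hyps[OF card_diff_transpose[OF S a b i] permutes_comp_transpose[OF a i(1) k(1)]]) simp
    also have "\<dots> \<le> defect S s a"
      using defect_transpose_le[OF S s a i(1) k(1) k(2)[symmetric] step(1)] .
    finally show ?thesis .
  next
    case False
    then have "a = b" using a b by (metis permutes_not_in ext)
    then show ?thesis by simp
  qed
qed

text \<open>Equality persists for a' = a \<circ> (i k), so nonnegative genus demands at least as
  many components of the pair \<open>b\<close>, a' as a' has cycles, which is
  \<open>cyc S a + 1\<close>. If \<open>i\<close> and \<open>k\<close> were connected, these
  components would be those of the pair \<open>b\<close>, \<open>a\<close>, of which there are at
  most \<open>cyc S a\<close>. For a single cycle \<open>a\<close> this says that \<open>b\<close>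
  preserves both segments into which the step breaks it.\<close>

lemma geodesic_separates:
  assumes S: "finite S" and b: "b permutes S" and a: "a permutes S"
    and eq: "cyc S b + cyc S (inv' b \<circ> a) = card S + cyc S a"
    and i: "i \<in> S" "a i \<noteq> b i"
  defines "k \<equiv> inv' a (b i)"
  shows "(i, k) \<notin> conn (edges S b \<union> edges S (a \<circ> Transposition.transpose i k))"
proof
  let ?t = "Transposition.transpose i k"
  have k: "k \<in> S" "k \<noteq> i" "a k = b i" using inv_apply_neq[OF a b i] unfolding k_def .
  note step = geodesic_step[OF S b a eq i, folded k_def]
  assume "(i, k) \<in> conn (edges S b \<union> edges S (a \<circ> ?t))"
  then have "num_classes S (edges S b \<union> edges S (a \<circ> ?t)) =
      num_classes S (insert (i, k) (edges S b \<union> edges S (a \<circ> ?t)))"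
    by (simp add: num_classes_insert_connected)
  also have "\<dots> = num_classes S (insert (i, k) (edges S b \<union> edges S a))"
    by (rule num_classes_cong[OF conn_insert_transpose[OF i(1) k(1)]])
  also have "\<dots> \<le> cyc S a"
    unfolding cyc_def using S by (intro num_classes_antimono) (auto intro: conn_edge)
  finally show False
    using defect_nonneg[OF S b permutes_comp_transpose[OF a i(1) k(1)]] step(2,3) eq
    by (simp add: defect_def)
qed

text \<open>Every edge is a bridge, so each insertion lowers the number of classes by exactly one.
  Edges are indexed by \<open>S\<close>, which allows \<open>card T\<close> to count them: a bridge
  cannot be repeated.\<close>

lemma forest_num_classes:
  assumes "finite V" "finite S" "\<And>x. x \<in> S \<Longrightarrow> f x \<in> V \<and> g x \<in> V"
    and sep: "\<And>x. x \<in> S \<Longrightarrow> (f x, g x) \<notin> conn ((\<lambda>x. (f x, g x)) ` (S - {x}))"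
    and "T \<subseteq> S"
  shows "num_classes V ((\<lambda>x. (f x, g x)) ` T) + card T = card V"
proof -
  have "finite T" using assms finite_subset by blast
  then show ?thesis using assms(5)
  proof (induction T)
    case empty
    then show ?case by (simp add: num_classes_empty)
  next
    case (insert x T)
    have "conn ((\<lambda>x. (f x, g x)) ` T) \<subseteq> conn ((\<lambda>x. (f x, g x)) ` (S - {x}))"
      using insert by (intro conn_mono) blast
    then have "(f x, g x) \<notin> conn ((\<lambda>x. (f x, g x)) ` T)" using sep insert by blast
    then show ?case
      using num_classes_insert_unconnected[of V "f x" "g x"] assms insert by simp
  qed
qed

text \<open>
  Removing the edge \<open>i\<close> from the bipartite graph on the cycles of \<open>b\<close> and of \<open>b\<inverse>a\<close> separates the \<open>b\<close>-cycles
  inside \<open>A\<close> from the \<open>b\<inverse>a\<close>-cycle of \<open>i\<close>. When \<open>a\<close> is one cycle, \<open>A\<close> is its segment from \<open>b i\<close> to \<open>i\<close>.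
\<close>

lemma noncrossing_cyc_ge:
  assumes S: "finite S" "S \<noteq> {}" and b: "b permutes S" and a: "a permutes S"
    and sep: "\<And>i. i \<in> S \<Longrightarrow> \<exists>A \<subseteq> S. i \<in> A \<and> b ` A \<subseteq> A \<and> a ` (A - {i}) \<subseteq> A \<and>
      (\<forall>x \<in> A. a x = b i \<longrightarrow> x = i)"
  shows "card S + 1 \<le> cyc S b + cyc S (inv' b \<circ> a)"
proof -
  let ?c = "inv' b \<circ> a"
  have c: "?c permutes S" using a b by (intro permutes_compose permutes_inv)
  \<comment> \<open>The sum type keeps the two kinds of cycles apart even when they coincide as
    sets.\<close>
  let ?f = "\<lambda>x. Inl (conn (edges S b) `` {x}) :: 'a set + 'a set"
  let ?g = "\<lambda>x. Inr (conn (edges S ?c) `` {x}) :: 'a set + 'a set"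
  let ?V = "?f ` S \<union> ?g ` S"
  have V: "card ?V = cyc S b + cyc S ?c"
  proof -
    have "?f ` S = Inl ` (\<lambda>x. conn (edges S b) `` {x}) ` S" "?g ` S = Inr ` (\<lambda>x. conn (edges S ?c) `` {x}) ` S"
      by (simp_all add: image_image)
    then have "card (?f ` S) = cyc S b" "card (?g ` S) = cyc S ?c"
      unfolding cyc_def num_classes_def by (simp_all add: card_image)
    moreover have "?f ` S \<inter> ?g ` S = {}" by blast
    ultimately show ?thesis using S by (simp add: card_Un_disjoint)
  qed
  have "(?f i, ?g i) \<notin> conn ((\<lambda>x. (?f x, ?g x)) ` (S - {i}))" if i: "i \<in> S" for i
  proof
    obtain A where A: "A \<subseteq> S" "i \<in> A" "b ` A \<subseteq> A" "a ` (A - {i}) \<subseteq> A" "\<forall>x \<in> A. a x = b i \<longrightarrow> x = i"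
      using sep[OF i] by blast
    have finA: "finite A" using A(1) S finite_subset by blast
    have "inj_on b A" using permutes_inj[OF b] by (rule inj_on_subset) simp
    then have bA: "b ` A = A" using finA A(3) endo_inj_surj by blast
    then have bA': "b x \<in> A \<longleftrightarrow> x \<in> A" for x
      using permutes_inj[OF b] by (metis (no_types, lifting) image_iff inj_eq)
    have cA1: "?c x \<in> A - {i}" if "x \<in> A - {i}" for x
    proof -
      have x: "b (?c x) = a x" using b by (simp add: permutes_inverses)
      then have "?c x \<in> A" using that A(4) bA' by (metis image_subset_iff)
      moreover have "?c x \<noteq> i" using x that A(5) by auto
      ultimately show ?thesis by blast
    qed
    have "inj_on ?c (A - {i})" using permutes_inj[OF c] by (rule inj_on_subset) simp
    then have "?c ` (A - {i}) = A - {i}" using finA cA1 by (intro endo_inj_surj) auto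
    then have cA: "?c x \<in> A - {i} \<longleftrightarrow> x \<in> A - {i}" for x
      using permutes_inj[OF c] by (metis (no_types, lifting) image_iff inj_eq)
    have ccb: "x \<in> A \<longleftrightarrow> y \<in> A" if "(x, y) \<in> conn (edges S b)" for x y
      using conn_closed[OF that] bA' by (metis edges_iff)
    have ccc: "x \<in> A - {i} \<longleftrightarrow> y \<in> A - {i}" if "(x, y) \<in> conn (edges S ?c)" for x y
      using conn_closed[OF that] cA by (metis edges_iff)
    \<comment> \<open>One side of the bridge: every edge other than \<open>i\<close> has both ends
      in \<open>W\<close> or neither, while the edge \<open>i\<close> has only its
      \<open>b\<close>-end there.\<close>
    define W where "W = ?f ` A \<union> ?g ` (A - {i})"
    have fW: "?f x \<in> W \<longleftrightarrow> x \<in> A" for x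
      unfolding W_def using ccb by (auto simp: conn_class_eq_iff)
    have gW: "?g x \<in> W \<longleftrightarrow> x \<in> A - {i}" for x
      unfolding W_def using ccc by (force simp: conn_class_eq_iff)
    assume "(?f i, ?g i) \<in> conn ((\<lambda>x. (?f x, ?g x)) ` (S - {i}))"
    then have "?f i \<in> W \<longleftrightarrow> ?g i \<in> W"
    proof (rule conn_closed)
      fix v w assume "(v, w) \<in> (\<lambda>x. (?f x, ?g x)) ` (S - {i})"
      then obtain x where "x \<noteq> i" "v = ?f x" "w = ?g x" by blast
      then show "v \<in> W \<longleftrightarrow> w \<in> W" using fW[of x] gW[of x] by simp
    qed
    then show False using A(2) fW[of i] gW[of i] by simp
  qed
  then have "num_classes ?V ((\<lambda>x. (?f x, ?g x)) ` S) + card S = card ?V"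
    using S by (intro forest_num_classes) auto
  moreover have "num_classes ?V ((\<lambda>x. (?f x, ?g x)) ` S) > 0"
    using S by (intro num_classes_pos) auto
  ultimately show ?thesis using V by simp
qed

section \<open>Curves in a disk\<close>

text \<open>Fashoda's theorem concerns a rectangle with four interlaced endpoints on its bottom
  side, so the disk without one free boundary point is first moved to the half plane.\<close>

lemma disk_arcs_cross:
  fixes f g :: "real \<Rightarrow> complex"
  assumes f: "path f" "f ` {0<..<1} \<subseteq> ball 0 1" "pathstart f = cis a" "pathfinish f = cis c"
    and g: "path g" "g ` {0<..<1} \<subseteq> ball 0 1" "pathstart g = cis b" "pathfinish g = cis d"
    and ord: "a < b" "b < c" "c < d" "d < a + 2 * pi"
  shows "path_image f \<inter> path_image g \<noteq> {}"
proof -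
  \<comment> \<open>A Cayley transform with its pole at \<open>cis \<theta>\<close>, off both paths, maps the disk to the upper half plane;
    on the circle, \<open>cis t\<close> goes to \<open>- cot ((t - \<theta>) / 2)\<close>, which is increasing in \<open>t\<close>.\<close>
  define \<theta> where "\<theta> = (a + d) / 2 - pi"
  define h where "h z = \<i> * (1 + z * cis (- \<theta>)) / (1 - z * cis (- \<theta>))" for z
  define X where "X = {z. norm z \<le> 1 \<and> z * cis (- \<theta>) \<noteq> 1}"
  have ball_X: "ball 0 1 \<subseteq> X"
  proof
    fix z :: complex assume "z \<in> ball 0 1"
    then have z: "norm z < 1" by simp
    then have "norm (z * cis (- \<theta>)) \<noteq> 1" by (simp add: norm_mult)
    then have "z * cis (- \<theta>) \<noteq> 1" by (metis norm_one)
    then show "z \<in> X" using z by (simp add: X_def)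
  qed
  have cis_X: "cis t \<in> X" and h_cis: "h (cis t) = of_real (- cot ((t - \<theta>) / 2))"
    if "a \<le> t" "t \<le> d" for t
  proof -
    define r where "r = (t - \<theta>) / 2"
    \<comment> \<open>\<open>\<theta>\<close> is the midpoint of \<open>d - 2 * pi\<close> and
      \<open>a\<close>, so it lies in the free arc, less than one turn below
      \<open>d\<close>.\<close>
    have "0 < r" "r < pi" using that ord by (auto simp: r_def \<theta>_def field_simps)
    then have s: "sin r > 0" by (rule sin_gt_zero)
    have "2 * r = t + - \<theta>" by (simp add: r_def)
    then have w: "cis t * cis (- \<theta>) = cis (2 * r)" by (simp only: cis_mult)
    have "Re (cis (2 * r)) \<noteq> 1" using s by (simp add: cos_double_sin)
    then have ne: "cis (2 * r) \<noteq> 1" by (metis one_complex.sel(1))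
    then show "cis t \<in> X" by (simp add: X_def w)
    have cot: "cot r * sin r = cos r" using s by (simp add: cot_def)
    have "sin (2 * r) = cot r * (1 - cos (2 * r))"
      unfolding sin_double cos_double_sin cot[symmetric] by (simp add: power2_eq_square)
    moreover have "1 + cos (2 * r) = cot r * sin (2 * r)"
      unfolding sin_double cos_double_cos cot[symmetric] by (simp add: power2_eq_square)
    ultimately have "\<i> * (1 + cis (2 * r)) = of_real (- cot r) * (1 - cis (2 * r))"
      by (simp add: complex_eq_iff)
    then show "h (cis t) = of_real (- cot ((t - \<theta>) / 2))"
      using ne unfolding h_def w by (simp add: r_def[symmetric] divide_eq_eq)
  qed
  have mono: "- cot ((s - \<theta>) / 2) < - cot ((t - \<theta>) / 2)" if "a \<le> s" "s < t" "t \<le> d" for s t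
  proof -
    define x y where "x = (s - \<theta>) / 2" and "y = (t - \<theta>) / 2"
    have "0 < x" "x < y" "y < pi" using that ord by (auto simp: \<theta>_def x_def y_def field_simps)
    then have "sin x > 0" "sin y > 0" "sin (y - x) > 0" by (auto intro!: sin_gt_zero)
    then have "- cot x < - cot y" by (simp add: cot_def divide_simps sin_diff mult.commute)
    then show ?thesis by (simp add: x_def y_def)
  qed
  have Im_h: "Im (h z) \<ge> 0" if "z \<in> X" for z
  proof -
    define w where "w = z * cis (- \<theta>)"
    have w: "norm w \<le> 1" using that by (simp add: w_def X_def norm_mult)
    then have "(Re w)\<^sup>2 + (Im w)\<^sup>2 \<le> 1"
      by (metis cmod_power2 norm_ge_zero power_le_one)
    then have "0 \<le> (1 + Re w) * (1 - Re w) - Im w * Im w"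
      by (simp add: algebra_simps power2_eq_square)
    moreover have "Im (h z) = ((1 + Re w) * (1 - Re w) - Im w * Im w) / ((1 - Re w)\<^sup>2 + (Im w)\<^sup>2)"
      unfolding h_def w_def[symmetric] by (simp add: Im_divide algebra_simps)
    ultimately show ?thesis by simp
  qed
  have path_X: "path_image p \<subseteq> X"
    if "p ` {0<..<1} \<subseteq> ball 0 1" "pathstart p \<in> X" "pathfinish p \<in> X" for p
  proof -
    have "{0..1::real} = {0<..<1} \<union> {0, 1}" by auto
    then have "path_image p = p ` {0<..<1} \<union> {pathstart p, pathfinish p}"
      by (simp add: path_image_def pathstart_def pathfinish_def)
    then show ?thesis using that ball_X by auto
  qed
  have fX: "path_image f \<subseteq> X" using f ord by (intro path_X) (auto intro: cis_X)
  have gX: "path_image g \<subseteq> X" using g ord by (intro path_X) (auto intro: cis_X)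
  define H :: "complex \<Rightarrow> real^2" where "H z = Re (h z) *\<^sub>R axis 1 1 + Im (h z) *\<^sub>R axis 2 1" for z
  have H: "H z $ 1 = Re (h z)" "H z $ 2 = Im (h z)" for z
    by (simp_all add: H_def axis_def)
  have cont: "continuous_on X h"
    unfolding h_def by (intro continuous_intros) (auto simp: X_def)
  then have contH: "continuous_on X H"
    unfolding H_def by (intro continuous_intros)
  have "compact (h ` (path_image f \<union> path_image g))"
    using f g fX gX cont by (intro compact_continuous_image) (auto intro: continuous_on_subset)
  then obtain B where B: "\<And>z. z \<in> path_image f \<union> path_image g \<Longrightarrow> norm (h z) \<le> B"
    by (metis bounded_iff compact_imp_bounded image_eqI)
  \<comment> \<open>The bottom side lies on the real axis, which contains the images of the four
    endpoints; the bound \<open>B\<close> on the norm bounds both coordinates.\<close>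
  let ?l = "vector [-B, 0] :: real^2" and ?u = "vector [B, B] :: real^2"
  have box: "H z \<in> cbox ?l ?u" if "z \<in> path_image f \<union> path_image g" for z
  proof -
    have "z \<in> X" using that fX gX by blast
    then show ?thesis
      using B[OF that] abs_Re_le_cmod[of "h z"] abs_Im_le_cmod[of "h z"] Im_h[of z]
      by (auto simp: mem_box_cart forall_2 H)
  qed
  have "path (H \<circ> f)" "path (H \<circ> g)"
    using f g fX gX contH by (auto intro!: path_continuous_image intro: continuous_on_subset)
  moreover have "path_image (H \<circ> f) \<subseteq> cbox ?l ?u" "path_image (H \<circ> g) \<subseteq> cbox ?l ?u"
    using box by (auto simp: path_image_compose)
  ultimately obtain z where "z \<in> path_image (H \<circ> f)" "z \<in> path_image (H \<circ> g)"
  proof (rule fashoda_interlace)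
    show "pathstart (H \<circ> f) $ 2 = ?l $ 2" "pathfinish (H \<circ> f) $ 2 = ?l $ 2"
      "pathstart (H \<circ> g) $ 2 = ?l $ 2" "pathfinish (H \<circ> g) $ 2 = ?l $ 2"
      "pathstart (H \<circ> f) $ 1 < pathstart (H \<circ> g) $ 1" "pathstart (H \<circ> g) $ 1 < pathfinish (H \<circ> f) $ 1"
      "pathfinish (H \<circ> f) $ 1 < pathfinish (H \<circ> g) $ 1"
      using f g ord mono by (simp_all add: pathstart_compose pathfinish_compose H h_cis)
  qed
  then obtain x y where xy: "x \<in> path_image f" "y \<in> path_image g" "H x = H y"
    by (auto simp: path_image_compose)
  then have "h x = h y" by (metis H complex_eq_iff)
  moreover have "x * cis (- \<theta>) \<noteq> 1" "y * cis (- \<theta>) \<noteq> 1" using xy fX gX by (auto simp: X_def)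
  ultimately have "x * cis (- \<theta>) = y * cis (- \<theta>)"
    unfolding h_def by (simp add: divide_simps) (simp add: algebra_simps)
  then have "x = y" by simp
  then show ?thesis using xy by blast
qed

text \<open>Twice the signed area of the triangle with vertices cis p, cis q, cis t; its sign tells
  on which side of the line through the first two the third lies. The formula holds because a chord
  is a half-angle sine times a direction of unit length.\<close>

lemma Im_cnj_chord:
  "Im (cnj (cis q - cis p) * (cis t - cis p)) =
     4 * sin ((q - p) / 2) * sin ((t - p) / 2) * sin ((t - q) / 2)"
proof -
  have *: "cis x - cis y = cis ((x + y) / 2) * (2 * \<i> * of_real (sin ((x - y) / 2)))" for x y
  proof -
    have "cis (m + d) - cis (m - d) = cis m * (2 * \<i> * of_real (sin d))" for m d
      by (simp add: complex_eq_iff cos_add cos_diff sin_add sin_diff)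
    from this[of "(x + y) / 2" "(x - y) / 2"] show ?thesis by (simp add: field_simps)
  qed
  have "cnj (cis q - cis p) * (cis t - cis p) =
      cis (- ((q + p) / 2)) * cis ((t + p) / 2) * of_real (4 * sin ((q - p) / 2) * sin ((t - p) / 2))"
    unfolding * by (simp add: cis_cnj)
  also have "cis (- ((q + p) / 2)) * cis ((t + p) / 2) = cis ((t - q) / 2)"
  proof -
    have "- ((q + p) / 2) + (t + p) / 2 = (t - q) / 2" by (simp add: field_simps)
    then show ?thesis by (simp only: cis_mult)
  qed
  finally show ?thesis by simp
qed

text \<open>Both ends of the second chord lie strictly on the same side of the line through the
  first. The alternatives in \<open>ts\<close> are the two open arcs between the ends of the first
  chord, with angles in (q, p) or in (p - 2 pi, q).\<close>

lemma chords_disjoint: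
  assumes pq: "q < p" "p < q + 2 * pi"
    and ts: "q < t \<and> t < p \<and> q < s \<and> s < p \<or> p < t + 2 * pi \<and> t < q \<and> p < s + 2 * pi \<and> s < q"
  shows "closed_segment (cis q) (cis p) \<inter> closed_segment (cis t) (cis s) = {}"
proof -
  define L where "L z = Im (cnj (cis q - cis p) * (z - cis p))" for z
  have aff: "L ((1 - u) *\<^sub>R x + u *\<^sub>R y) = (1 - u) * L x + u * L y" for u x y
    by (simp add: L_def algebra_simps)
  have pos: "sin (x / 2) > 0" if "0 < x" "x < 2 * pi" for x :: real
    using that by (intro sin_gt_zero) auto
  have neg: "sin (x / 2) < 0" if "- 2 * pi < x" "x < 0" for x :: real
    using pos[of "- x"] that by simp
  have qp: "sin ((q - p) / 2) < 0" using pq by (intro neg) auto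
  have "0 < L (cis t) \<and> 0 < L (cis s) \<or> L (cis t) < 0 \<and> L (cis s) < 0"
    using ts
  proof
    assume "q < t \<and> t < p \<and> q < s \<and> s < p"
    then have "sin ((t - p) / 2) < 0" "sin ((s - p) / 2) < 0" "sin ((t - q) / 2) > 0" "sin ((s - q) / 2) > 0"
      using pq by (auto intro!: neg pos)
    then show ?thesis unfolding L_def Im_cnj_chord using qp by (simp add: mult_pos_pos mult_neg_neg)
  next
    assume "p < t + 2 * pi \<and> t < q \<and> p < s + 2 * pi \<and> s < q"
    then have "sin ((t - p) / 2) < 0" "sin ((s - p) / 2) < 0" "sin ((t - q) / 2) < 0" "sin ((s - q) / 2) < 0"
      using pq by (auto intro!: neg)
    then show ?thesis unfolding L_def Im_cnj_chord using qp by (simp add: mult_neg_neg mult_pos_neg)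
  qed
  moreover have "0 < L z" if "z \<in> closed_segment x y" "0 < L x" "0 < L y" for x y z
  proof -
    obtain u where u: "z = (1 - u) *\<^sub>R x + u *\<^sub>R y" "0 \<le> u" "u \<le> 1"
      using \<open>z \<in> closed_segment x y\<close> by (auto simp: in_segment)
    show ?thesis unfolding u(1) aff using u that by (cases "u = 0") (auto intro: add_nonneg_pos)
  qed
  moreover have "L z < 0" if "z \<in> closed_segment x y" "L x < 0" "L y < 0" for x y z
  proof -
    obtain u where u: "z = (1 - u) *\<^sub>R x + u *\<^sub>R y" "0 \<le> u" "u \<le> 1"
      using \<open>z \<in> closed_segment x y\<close> by (auto simp: in_segment)
    show ?thesis unfolding u(1) aff using u that
      by (cases "u = 0") (auto intro: add_nonpos_neg simp: mult_nonneg_nonpos mult_pos_neg)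
  qed
  moreover have "L z = 0" if "z \<in> closed_segment (cis q) (cis p)" for z
  proof -
    have "L (cis q) = 0" "L (cis p) = 0" unfolding L_def Im_cnj_chord by simp_all
    then show ?thesis using that by (auto simp: in_segment aff)
  qed
  ultimately show ?thesis by (metis disjoint_iff less_irrefl)
qed

lemma disk_param_inv_into:
  assumes "disk_param \<phi>"
  shows "continuous_on (area \<phi>) (inv_into (cball 0 1) \<phi>)"
    and "\<And>z. z \<in> cball 0 1 \<Longrightarrow> inv_into (cball 0 1) \<phi> (\<phi> z) = z"
    and "\<And>w. w \<in> area \<phi> \<Longrightarrow> \<phi> (inv_into (cball 0 1) \<phi> w) = w"
proof -
  have \<phi>: "continuous_on (cball 0 1) \<phi>" "inj_on \<phi> (cball 0 1)"
    using assms by (auto simp: disk_param_def)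
  show k: "inv_into (cball 0 1) \<phi> (\<phi> z) = z" if "z \<in> cball 0 1" for z
    using \<phi>(2) that by (rule inv_into_f_f)
  show "\<phi> (inv_into (cball 0 1) \<phi> w) = w" if "w \<in> area \<phi>" for w
    using that by (simp add: area_def f_inv_into_f)
  show "continuous_on (area \<phi>) (inv_into (cball 0 1) \<phi>)"
    unfolding area_def by (rule continuous_on_inv[OF \<phi>(1)]) (use k in auto)
qed

lemma path_image_subset_area:
  assumes "f ` {0<..<1} \<subseteq> \<phi> ` ball 0 1" "pathstart f = \<phi> (cis a)" "pathfinish f = \<phi> (cis b)"
  shows "path_image f \<subseteq> area \<phi>"
proof -
  have "{0..1::real} = {0<..<1} \<union> {0, 1}" by auto
  then have "path_image f = f ` {0<..<1} \<union> {pathstart f, pathfinish f}"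
    by (simp add: path_image_def pathstart_def pathfinish_def)
  moreover have "\<phi> ` ball 0 1 \<subseteq> area \<phi>" unfolding area_def by (intro image_mono ball_subset_cball)
  ultimately show ?thesis using assms by (auto simp: area_def)
qed

lemma area_arcs_cross:
  assumes \<phi>: "disk_param \<phi>"
    and f: "path f" "f ` {0<..<1} \<subseteq> \<phi> ` ball 0 1" "pathstart f = \<phi> (cis a)" "pathfinish f = \<phi> (cis c)"
    and g: "path g" "g ` {0<..<1} \<subseteq> \<phi> ` ball 0 1" "pathstart g = \<phi> (cis b)" "pathfinish g = \<phi> (cis d)"
    and ord: "a < b" "b < c" "c < d" "d < a + 2 * pi"
  shows "path_image f \<inter> path_image g \<noteq> {}"
proof -
  let ?k = "inv_into (cball 0 1) \<phi>"
  note k = disk_param_inv_into[OF \<phi>]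
  have in_ball: "(?k \<circ> p) ` {0<..<1} \<subseteq> ball 0 1" if "p ` {0<..<1} \<subseteq> \<phi> ` ball 0 1" for p :: "real \<Rightarrow> complex"
  proof -
    have "?k ` \<phi> ` ball 0 1 \<subseteq> ball 0 1" using k(2) by auto
    then show ?thesis using that by (simp only: image_comp[symmetric]) blast
  qed
  have fi: "path_image f \<subseteq> area \<phi>" and gi: "path_image g \<subseteq> area \<phi>"
    using path_image_subset_area[OF f(2-4)] path_image_subset_area[OF g(2-4)] .
  have "path_image (?k \<circ> f) \<inter> path_image (?k \<circ> g) \<noteq> {}"
  proof (rule disk_arcs_cross[OF _ _ _ _ _ _ _ _ ord])
    show "path (?k \<circ> f)" "path (?k \<circ> g)"
      using f g fi gi k(1) by (auto intro!: path_continuous_image intro: continuous_on_subset)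
  qed (use f g in_ball in \<open>auto simp: pathstart_compose pathfinish_compose k(2)\<close>)
  then obtain x y where "x \<in> path_image f" "y \<in> path_image g" "?k x = ?k y"
    by (auto simp: path_image_compose)
  moreover from this have "x = y" using fi gi k(3) by (metis subsetD)
  ultimately show ?thesis by blast
qed

text \<open>Strict convexity: an inner point of a chord is closer to the centre than one of its
  ends.\<close>

lemma open_segment_cis_subset_ball:
  "open_segment (cis a) (cis b) \<subseteq> ball 0 1"
proof
  fix z assume "z \<in> open_segment (cis a) (cis b)"
  then have "dist 0 z < dist 0 (cis a) \<or> dist 0 z < dist 0 (cis b)"
    by (rule dist_decreases_open_segment[rule_format])
  then show "z \<in> ball 0 1" by simp
qed

section \<open>Cuts in the paper model\<close>

lemma concat_triples_nth:
  assumes "l < length xs"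
  shows "concat (map (\<lambda>x. [f x, g x, h x]) xs) ! (3 * l) = f (xs ! l)"
    and "concat (map (\<lambda>x. [f x, g x, h x]) xs) ! (3 * l + 2) = h (xs ! l)"
  using assms
proof (induction xs arbitrary: l)
  case (Cons x xs)
  {
    case 1
    then show ?case using Cons.IH(1)[of "l - 1"] by (cases l) (auto simp: numeral_3_eq_3)
  next
    case 2
    then show ?case using Cons.IH(2)[of "l - 1"] by (cases l) (auto simp: numeral_3_eq_3)
  }
qed simp_all

lemma length_concat_triples: "length (concat (map (\<lambda>x. [f x, g x, h x]) xs)) = 3 * length xs"
  by (induction xs) auto

locale drawing =
  fixes n :: nat and \<sigma> \<alpha> :: "nat \<Rightarrow> nat" and M :: paper
  assumes perm: "\<sigma> permutes {1..n}" "\<alpha> permutes {1..n}"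
    and model: "paper_model n \<sigma> \<alpha> M"
begin

lemma permutation_\<alpha>: "permutation \<alpha>"
  using perm(2) by (intro permutes_imp_permutation[of "{1..n}"]) simp_all

definition par :: "nat \<Rightarrow> complex \<Rightarrow> complex" where
  "par x = hyperedge_param M (orbit \<alpha> x)"

lemma cycleI: "x \<in> {1..n} \<Longrightarrow> orbit \<alpha> x \<in> cycles {1..n} \<alpha>"
  by (simp add: cycles_def)

lemma disk_param_par: "x \<in> {1..n} \<Longrightarrow> disk_param (par x)"
  using model cycleI by (simp add: paper_model_def par_def)

text \<open>
  \<open>P l\<close> and \<open>N l\<close> are the angles of \<open>i\<^sup>+\<close> and \<open>i\<^sup>-\<close> for the \<open>l\<close>-th point \<open>i\<close> of the cycle, counted from \<open>x\<close>;
  clockwise means that they decrease.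
\<close>

lemma mark_angles:
  assumes x: "x \<in> {1..n}"
  obtains P N :: "nat \<Rightarrow> real" where
    "\<And>l. l < least_power \<alpha> x \<Longrightarrow> position M (Plus ((\<alpha> ^^ l) x)) = par x (cis (P l))"
    "\<And>l. l < least_power \<alpha> x \<Longrightarrow> position M (Minus ((\<alpha> ^^ l) x)) = par x (cis (N l))"
    "\<And>l. l < least_power \<alpha> x \<Longrightarrow> P l < N l"
    "\<And>l m. l < m \<Longrightarrow> m < least_power \<alpha> x \<Longrightarrow> N m < P l"
    "\<And>l m. l < least_power \<alpha> x \<Longrightarrow> m < least_power \<alpha> x \<Longrightarrow> N l < P m + 2 * pi"
proof -
  let ?K = "least_power \<alpha> x"
  let ?L = "concat (map (\<lambda>j. [position M (Minus j), attach M j, position M (Plus j)]) (support \<alpha> x))"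
  have "clockwise (par x) ?L"
    using model x unfolding paper_model_def par_def by blast
  have len: "length ?L = 3 * ?K" by (simp only: length_concat_triples) simp
  from \<open>clockwise (par x) ?L\<close> obtain t :: "nat \<Rightarrow> real" where
    tL: "\<forall>k < 3 * ?K. ?L ! k = par x (cis (t k))"
    and ordL: "\<forall>j k. j < k \<and> k < 3 * ?K \<longrightarrow> t k < t j \<and> t j < t k + 2 * pi"
    unfolding clockwise_def len by (elim exE conjE)
  note t = tL[rule_format] and ord = ordL[rule_format, OF conjI]
  define P N where "P l = t (3 * l + 2)" and "N l = t (3 * l)" for l
  have PN: "P l < N l" if "l < ?K" for l
    using ord[of "3 * l" "3 * l + 2"] that by (simp add: P_def N_def)
  have NP: "N m < P l" if "l < m" "m < ?K" for l m
    using ord[of "3 * l + 2" "3 * m"] that by (simp add: P_def N_def)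
  show ?thesis
  proof (rule that)
    show "position M (Plus ((\<alpha> ^^ l) x)) = par x (cis (P l))" if l: "l < ?K" for l
    proof -
      have "?L ! (3 * l + 2) = position M (Plus (support \<alpha> x ! l))"
        by (rule concat_triples_nth(2)) (use l in simp)
      then show ?thesis using t[of "3 * l + 2"] l by (simp add: P_def)
    qed
    show "position M (Minus ((\<alpha> ^^ l) x)) = par x (cis (N l))" if l: "l < ?K" for l
    proof -
      have "?L ! (3 * l) = position M (Minus (support \<alpha> x ! l))"
        by (rule concat_triples_nth(1)) (use l in simp)
      then show ?thesis using t[of "3 * l"] l by (simp add: N_def)
    qed
    show "N l < P m + 2 * pi" if "l < ?K" "m < ?K" for l m
    proof (cases "l \<le> m")
      case True
      then show ?thesis using ord[of "3 * l" "3 * m + 2"] that by (simp add: P_def N_def)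
    next
      case False
      then have "N l < P m" using NP that by simp
      then show ?thesis using pi_gt_zero by linarith
    qed
  qed (fact PN NP)+
qed

lemma orbit_\<alpha>_subset: "x \<in> {1..n} \<Longrightarrow> orbit \<alpha> x \<subseteq> {1..n}"
  using perm(2) by (simp add: permutes_orbit_subset)

lemma self_in_orbit: "x \<in> orbit \<alpha> x"
  by (rule permutation_self_in_orbit[OF permutation_\<alpha>])

lemma orbit_eq: "y \<in> orbit \<alpha> x \<Longrightarrow> orbit \<alpha> y = orbit \<alpha> x"
  using orbit_trans orbit_swap[OF self_in_orbit] by (metis subsetI subset_antisym)

lemma cycle_eq_orbit: "c \<in> cycles {1..n} \<alpha> \<Longrightarrow> i \<in> c \<Longrightarrow> c = orbit \<alpha> i"
  unfolding cycles_def using orbit_eq by blast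

lemma cut_curveD:
  assumes "cut_curve n \<alpha> M i j \<gamma>"
  shows "i \<in> {1..n}" "j \<in> orbit \<alpha> i" "arc \<gamma>" "\<gamma> ` {0<..<1} \<subseteq> par i ` ball 0 1"
    "pathstart \<gamma> = position M (Plus i)" "pathfinish \<gamma> = position M (Minus j)"
proof -
  obtain c where c: "c \<in> cycles {1..n} \<alpha>" "i \<in> c" "j \<in> c" "\<gamma> ` {0<..<1} \<subseteq> hyperedge_param M c ` ball 0 1"
    using assms unfolding cut_curve_def by blast
  have co: "c = orbit \<alpha> i" using cycle_eq_orbit c by blast
  show "j \<in> orbit \<alpha> i" "\<gamma> ` {0<..<1} \<subseteq> par i ` ball 0 1" using c co by (simp_all add: par_def)
  show "i \<in> {1..n}" using c(1,2) orbit_\<alpha>_subset unfolding cycles_def by blast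
qed (use assms in \<open>simp_all add: cut_curve_def\<close>)

lemma orbit_index:
  assumes "y \<in> orbit \<alpha> x" obtains l where "l < least_power \<alpha> x" "y = (\<alpha> ^^ l) x"
proof -
  have "y \<in> range (\<lambda>i. (\<alpha> ^^ i) x)" using assms by (auto simp: orbit_altdef)
  then have "y \<in> set (support \<alpha> x)" by (simp only: support_set[OF permutation_\<alpha>])
  then show ?thesis using that by auto
qed

lemma funpow_in_orbit: "(\<alpha> ^^ l) x \<in> orbit \<alpha> x"
  unfolding orbit_altdef_permutation[OF permutation_\<alpha>] by blast

lemma par_eq: "y \<in> orbit \<alpha> x \<Longrightarrow> par y = par x"
  by (simp add: par_def orbit_eq)

text \<open>Counted from the target \<open>x\<close> of the first cut, the second cut starts inside
  the segment 0, ..., m and ends beyond it.\<close>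

lemma cuts_cross:
  assumes x: "x \<in> {1..n}" and rs: "r < m" "m < s" "s < least_power \<alpha> x"
    and f: "cut_curve n \<alpha> M ((\<alpha> ^^ m) x) x f"
    and g: "cut_curve n \<alpha> M ((\<alpha> ^^ r) x) ((\<alpha> ^^ s) x) g"
  shows "path_image f \<inter> path_image g \<noteq> {}"
proof -
  obtain P N where
    pos: "\<And>l. l < least_power \<alpha> x \<Longrightarrow> position M (Plus ((\<alpha> ^^ l) x)) = par x (cis (P l))"
      "\<And>l. l < least_power \<alpha> x \<Longrightarrow> position M (Minus ((\<alpha> ^^ l) x)) = par x (cis (N l))"
    and PN: "\<And>l. l < least_power \<alpha> x \<Longrightarrow> P l < N l"
    and NP: "\<And>l m. l < m \<Longrightarrow> m < least_power \<alpha> x \<Longrightarrow> N m < P l"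
    and per: "\<And>l m. l < least_power \<alpha> x \<Longrightarrow> m < least_power \<alpha> x \<Longrightarrow> N l < P m + 2 * pi"
    using mark_angles[OF x] by blast
  note fD = cut_curveD[OF f] and gD = cut_curveD[OF g]
  have par: "par ((\<alpha> ^^ l) x) = par x" for l by (rule par_eq[OF funpow_in_orbit])
  \<comment> \<open>Angles decrease along the cycle, so \<open>N s < P m < P r < N 0\<close>. After
    reversal \<open>g\<close> joins the first of these to the third, while \<open>f\<close> joins
    the second to the fourth.\<close>
  have "path_image (reversepath g) \<inter> path_image f \<noteq> {}"
  proof (rule area_arcs_cross[OF disk_param_par[OF x]])
    show "path (reversepath g)" "path f" using fD(3) gD(3) by (simp_all add: arc_imp_path)
    have "reversepath g ` {0<..<1} \<subseteq> g ` {0<..<1}" by (auto simp: reversepath_def)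
    then show "reversepath g ` {0<..<1} \<subseteq> par x ` ball 0 1" using gD(4) par by simp
    show "f ` {0<..<1} \<subseteq> par x ` ball 0 1" using fD(4) par by simp
    show "pathstart (reversepath g) = par x (cis (N s))" "pathfinish (reversepath g) = par x (cis (P r))"
      using gD(5,6) pos rs by simp_all
    show "pathstart f = par x (cis (P m))" "pathfinish f = par x (cis (N 0))"
      using fD(5,6) pos(1)[of m] pos(2)[of 0] rs by simp_all
    show "N s < P m" using NP rs by simp
    show "P m < P r" using NP[of r m] PN[of m] rs by simp
    show "P r < N 0" using PN[of r] NP[of 0 r] PN[of 0] rs by (cases "r = 0") auto
    show "N 0 < N s + 2 * pi" using per[of 0 s] PN[of s] rs by simp
  qed
  then show ?thesis by auto
qed

text \<open>The ends are recovered from the marks rather than from angles, which depend on where the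
  counting starts. Thus one function provides the curves of all cuts at once.\<close>

definition chord :: "nat \<times> nat \<Rightarrow> real \<Rightarrow> complex" where
  "chord = (\<lambda>(i, j). par i \<circ>
     linepath (inv_into (cball 0 1) (par i) (position M (Plus i)))
       (inv_into (cball 0 1) (par i) (position M (Minus j))))"

lemma chord_eq:
  assumes x: "x \<in> {1..n}" and i: "i \<in> orbit \<alpha> x"
    and pos: "position M (Plus i) = par x (cis a)" "position M (Minus j) = par x (cis b)"
  shows "chord (i, j) = par x \<circ> linepath (cis a) (cis b)"
  using disk_param_inv_into(2)[OF disk_param_par[OF x]] par_eq[OF i] pos by (simp add: chord_def)

lemma closed_segment_cis: "closed_segment (cis a) (cis b) \<subseteq> cball 0 1"
  by (rule closed_segment_subset) auto

lemma chord_image: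
  assumes "x \<in> {1..n}" "i \<in> orbit \<alpha> x"
    "position M (Plus i) = par x (cis a)" "position M (Minus j) = par x (cis b)"
  shows "path_image (chord (i, j)) = par x ` closed_segment (cis a) (cis b)"
    and "path_image (chord (i, j)) \<subseteq> area (par x)"
  using closed_segment_cis[of a b]
  by (auto simp: chord_eq[OF assms] path_image_compose area_def)

lemma cut_curve_chord:
  assumes i: "i \<in> {1..n}" and j: "j \<in> orbit \<alpha> i" and ne: "position M (Plus i) \<noteq> position M (Minus j)"
  shows "cut_curve n \<alpha> M i j (chord (i, j))"
    and "path_image (chord (i, j)) \<subseteq> area (par i)"
proof -
  obtain l where l: "l < least_power \<alpha> i" "j = (\<alpha> ^^ l) i" using orbit_index[OF j] .
  obtain P N where
    pos: "\<And>l. l < least_power \<alpha> i \<Longrightarrow> position M (Plus ((\<alpha> ^^ l) i)) = par i (cis (P l))"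
      "\<And>l. l < least_power \<alpha> i \<Longrightarrow> position M (Minus ((\<alpha> ^^ l) i)) = par i (cis (N l))"
    and "\<And>l. l < least_power \<alpha> i \<Longrightarrow> P l < N l"
    and "\<And>l m. l < m \<Longrightarrow> m < least_power \<alpha> i \<Longrightarrow> N m < P l"
    and "\<And>l m. l < least_power \<alpha> i \<Longrightarrow> m < least_power \<alpha> i \<Longrightarrow> N l < P m + 2 * pi"
    using mark_angles[OF i] by blast
  have posi: "position M (Plus i) = par i (cis (P 0))" "position M (Minus j) = par i (cis (N l))"
    using pos(1)[of 0] pos(2)[OF l(1)] l by auto
  have ne': "cis (P 0) \<noteq> cis (N l)" using ne posi by auto
  note eq = chord_eq[OF i self_in_orbit posi]
  show "path_image (chord (i, j)) \<subseteq> area (par i)" by (rule chord_image(2)[OF i self_in_orbit posi])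
  have \<phi>: "continuous_on (cball 0 1) (par i)" "inj_on (par i) (cball 0 1)"
    using disk_param_par[OF i] by (auto simp: disk_param_def)
  have "arc (chord (i, j))"
    unfolding arc_def
  proof
    show "path (chord (i, j))" unfolding eq using closed_segment_cis \<phi>(1)
      by (intro path_continuous_image) (auto intro: continuous_on_subset)
    have "inj_on (par i) (linepath (cis (P 0)) (cis (N l)) ` {0..1})"
      using inj_on_subset[OF \<phi>(2) closed_segment_cis] by (simp add: linepath_image_01)
    moreover have "inj_on (linepath (cis (P 0)) (cis (N l))) {0..1}"
      using arc_linepath[OF ne'] by (simp add: arc_def)
    ultimately show "inj_on (chord (i, j)) {0..1}" unfolding eq by (intro comp_inj_on)
  qed
  moreover have "chord (i, j) ` {0<..<1} \<subseteq> par i ` ball 0 1"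
  proof -
    have "linepath (cis (P 0)) (cis (N l)) ` {0<..<1} \<subseteq> open_segment (cis (P 0)) (cis (N l))"
      using ne' by (auto simp: in_segment linepath_def)
    then have "linepath (cis (P 0)) (cis (N l)) ` {0<..<1} \<subseteq> ball 0 1"
      using open_segment_cis_subset_ball by (rule order_trans)
    then show ?thesis unfolding eq image_comp[symmetric] by (rule image_mono)
  qed
  moreover have "pathstart (chord (i, j)) = position M (Plus i)" "pathfinish (chord (i, j)) = position M (Minus j)"
    unfolding eq by (simp_all add: pathstart_compose pathfinish_compose posi)
  ultimately show "cut_curve n \<alpha> M i j (chord (i, j))"
    unfolding cut_curve_def using cycleI[OF i] self_in_orbit j by (auto simp: par_def)
qed

lemma position_neq:
  assumes i: "i \<in> {1..n}" and j: "j \<in> orbit \<alpha> i" and "j \<noteq> \<alpha> i"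
  shows "position M (Plus i) \<noteq> position M (Minus j)"
proof -
  have "i \<in> orbit \<alpha> j" "j \<in> {1..n}"
    using orbit_eq[OF j] self_in_orbit orbit_\<alpha>_subset[OF i] j by auto
  then obtain m where m: "m < least_power \<alpha> j" "i = (\<alpha> ^^ m) j" using orbit_index by blast
  obtain P N where
    pos: "\<And>l. l < least_power \<alpha> j \<Longrightarrow> position M (Plus ((\<alpha> ^^ l) j)) = par j (cis (P l))"
      "\<And>l. l < least_power \<alpha> j \<Longrightarrow> position M (Minus ((\<alpha> ^^ l) j)) = par j (cis (N l))"
    and PN: "\<And>l. l < least_power \<alpha> j \<Longrightarrow> P l < N l"
    and NP: "\<And>l m. l < m \<Longrightarrow> m < least_power \<alpha> j \<Longrightarrow> N m < P l"
    and per: "\<And>l m. l < least_power \<alpha> j \<Longrightarrow> m < least_power \<alpha> j \<Longrightarrow> N l < P m + 2 * pi"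
    using mark_angles[OF \<open>j \<in> {1..n}\<close>] by blast
  \<comment> \<open>Counted from \<open>j\<close>, the two angles differ by more than 0 and less
    than one turn, so they give different points of the circle.\<close>
  have "P m < N 0" using PN[of m] NP[of 0 m] PN[of 0] m by (cases "m = 0") auto
  moreover have "N 0 < P m + 2 * pi" using per m by simp
  ultimately have "sin ((N 0 - P m) / 2) > 0" by (intro sin_gt_zero) auto
  then have "cos (N 0 - P m) \<noteq> 1"
    using cos_double_sin[of "(N 0 - P m) / 2"] by (simp del: right_diff_distrib_numeral)
  moreover have "cos (N 0 - P m) = 1" if "cis (P m) = cis (N 0)"
  proof -
    have "cis (N 0 - P m) = 1" using that by (simp flip: cis_divide)
    then show ?thesis by (metis cis.sel(1) one_complex.sel(1))
  qed
  ultimately have "cis (P m) \<noteq> cis (N 0)" by blast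
  moreover have "inj_on (par j) (cball 0 1)"
    using disk_param_par[OF \<open>j \<in> {1..n}\<close>] by (auto simp: disk_param_def)
  ultimately have "par j (cis (P m)) \<noteq> par j (cis (N 0))" by (auto simp: inj_on_eq_iff)
  then show ?thesis using pos(1)[of m] pos(2)[of 0] m by simp
qed

text \<open>The first chord ends at the plus mark of index m and the minus mark of index 0, so these
  indices are taken. Minus mark m still belongs to the cut-off side, because it precedes plus mark m
  on the outline; this is why \<open>s \<le> m\<close> stands beside \<open>r < m\<close>.\<close>

lemma chords_do_not_cross:
  assumes x: "x \<in> {1..n}" and m: "m < least_power \<alpha> x"
    and rs: "r < least_power \<alpha> x" "s < least_power \<alpha> x"
    and side: "r < m \<and> 0 < s \<and> s \<le> m \<or> m < r \<and> m < s"
  shows "path_image (chord ((\<alpha> ^^ m) x, x)) \<inter> path_image (chord ((\<alpha> ^^ r) x, (\<alpha> ^^ s) x)) = {}"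
proof -
  obtain P N where
    pos: "\<And>l. l < least_power \<alpha> x \<Longrightarrow> position M (Plus ((\<alpha> ^^ l) x)) = par x (cis (P l))"
      "\<And>l. l < least_power \<alpha> x \<Longrightarrow> position M (Minus ((\<alpha> ^^ l) x)) = par x (cis (N l))"
    and PN: "\<And>l. l < least_power \<alpha> x \<Longrightarrow> P l < N l"
    and NP: "\<And>l m. l < m \<Longrightarrow> m < least_power \<alpha> x \<Longrightarrow> N m < P l"
    and per: "\<And>l m. l < least_power \<alpha> x \<Longrightarrow> m < least_power \<alpha> x \<Longrightarrow> N l < P m + 2 * pi"
    using mark_angles[OF x] by blast
  have P: "P k < P l" if "l < k" "k < least_power \<alpha> x" for k l
    using NP[OF that] PN[OF that(2)] by simp
  have N: "N k < N l" if "l < k" "k < least_power \<alpha> x" for k l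
    using NP[OF that] PN[of l] that by simp
  have c1: "path_image (chord ((\<alpha> ^^ m) x, x)) = par x ` closed_segment (cis (P m)) (cis (N 0))"
    using chord_image(1)[OF x funpow_in_orbit pos(1)[OF m], of x "N 0"] pos(2)[of 0] m by simp
  have c2: "path_image (chord ((\<alpha> ^^ r) x, (\<alpha> ^^ s) x)) = par x ` closed_segment (cis (P r)) (cis (N s))"
    by (rule chord_image(1)[OF x funpow_in_orbit pos(1)[OF rs(1)] pos(2)[OF rs(2)]])
  have PN0: "P l < N 0" if "l < least_power \<alpha> x" for l
    using PN[OF that] N[of 0 l] that by (cases "l = 0") auto
  have "closed_segment (cis (P m)) (cis (N 0)) \<inter> closed_segment (cis (P r)) (cis (N s)) = {}"
  proof (rule chords_disjoint)
    show "P m < N 0" "N 0 < P m + 2 * pi" using PN0 per m by simp_all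
    show "P m < P r \<and> P r < N 0 \<and> P m < N s \<and> N s < N 0 \<or>
        N 0 < P r + 2 * pi \<and> P r < P m \<and> N 0 < N s + 2 * pi \<and> N s < P m"
      using side
    proof
      assume a: "r < m \<and> 0 < s \<and> s \<le> m"
      then have "P m < N s" using PN[OF m] N[of s m] m by (cases "s = m") auto
      then show ?thesis using a P[of r m] PN0[OF rs(1)] N[of 0 s] m rs by simp
    next
      assume a: "m < r \<and> m < s"
      then show ?thesis using P[of m r] NP[of m s] per[of 0 r] per[of 0 s] PN[of s] m rs by simp
    qed
  qed
  moreover have "inj_on (par x) (cball 0 1)"
    using disk_param_par[OF x] by (auto simp: disk_param_def)
  ultimately show ?thesis unfolding c1 c2
    using closed_segment_cis by (metis image_empty inj_on_image_Int)
qed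

end

section \<open>Outcomes and refinements\<close>

lemma perm_restrict_permutes:
  assumes "f permutes S" "finite c" "f ` c \<subseteq> c" shows "perm_restrict f c permutes c"
proof (rule bij_imp_permutes)
  have "inj_on f c" using permutes_inj[OF assms(1)] by (rule inj_on_subset) simp
  moreover from this have "f ` c = c" using assms(2,3) endo_inj_surj by blast
  ultimately have "bij_betw f c c" by (simp add: bij_betw_def)
  then show "bij_betw (perm_restrict f c) c c"
    by (rule bij_betw_cong[THEN iffD1, rotated]) (simp add: perm_restrict_simps)
qed (simp add: perm_restrict_simps)

text \<open>The inverse of \<open>cut_perm\<close> on refinements; the trivial pairs, which (R1)
  forbids as cuts, are left out.\<close>

definition cut_pairs :: "nat \<Rightarrow> (nat \<Rightarrow> nat) \<Rightarrow> (nat \<Rightarrow> nat) \<Rightarrow> (nat \<times> nat) set" where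
  "cut_pairs n \<alpha> \<beta> = {(i, \<beta> i) | i. i \<in> {1..n} \<and> \<beta> i \<noteq> \<alpha> i}"

lemma cut_perm_cut_pairs:
  assumes "\<beta> permutes {1..n}" "\<alpha> permutes {1..n}"
  shows "cut_perm \<alpha> (cut_pairs n \<alpha> \<beta>) = \<beta>"
proof
  fix i
  show "cut_perm \<alpha> (cut_pairs n \<alpha> \<beta>) i = \<beta> i"
  proof (cases "i \<in> {1..n} \<and> \<beta> i \<noteq> \<alpha> i")
    case True
    then have "(i, j) \<in> cut_pairs n \<alpha> \<beta> \<longleftrightarrow> j = \<beta> i" for j by (auto simp: cut_pairs_def)
    then show ?thesis by (simp add: cut_perm_def)
  next
    case False
    then have "(i, j) \<notin> cut_pairs n \<alpha> \<beta>" for j by (auto simp: cut_pairs_def)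
    moreover have "\<alpha> i = \<beta> i" using False assms permutes_not_in by metis
    ultimately show ?thesis by (simp add: cut_perm_def)
  qed
qed

context drawing
begin

lemma funpow_eq_iff:
  assumes "l < least_power \<alpha> x" "m < least_power \<alpha> x"
  shows "(\<alpha> ^^ l) x = (\<alpha> ^^ m) x \<longleftrightarrow> l = m"
proof -
  have "distinct (support \<alpha> x)" by (rule cycle_of_permutation[OF permutation_\<alpha>])
  then show ?thesis using nth_eq_iff_index_eq[of "support \<alpha> x" l m] assms by simp
qed

lemma least_power_pos: "least_power \<alpha> x > 0" and funpow_least_power: "(\<alpha> ^^ least_power \<alpha> x) x = x"
  using least_power_of_permutation[OF permutation_\<alpha>] by blast+

lemma \<alpha>_in_orbit: "y \<in> orbit \<alpha> x \<Longrightarrow> \<alpha> y \<in> orbit \<alpha> x"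
  by (rule orbit.step)

lemma finite_orbit_\<alpha>: "finite (orbit \<alpha> x)"
  by (rule finite_orbit[OF self_in_orbit])

abbreviation \<alpha>_on where "\<alpha>_on c \<equiv> perm_restrict \<alpha> c"

lemma \<alpha>_on_permutes: "\<alpha>_on (orbit \<alpha> x) permutes orbit \<alpha> x"
  by (rule perm_restrict_permutes[OF perm(2) finite_orbit_\<alpha>]) (auto intro: \<alpha>_in_orbit)

lemma cyc_\<alpha>_on: "cyc (orbit \<alpha> x) (\<alpha>_on (orbit \<alpha> x)) = 1"
proof -
  let ?c = "orbit \<alpha> x"
  have "cyclic_on (\<alpha>_on ?c) ?c"
    unfolding cyclic_on_perm_restrict by (rule cyclic_on_orbit'[OF permutation_\<alpha>])
  then have "orbit (\<alpha>_on ?c) y = ?c" if "y \<in> ?c" for y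
    using that unfolding cyclic_on_alldef by blast
  then have "orbit (\<alpha>_on ?c) ` ?c = {?c}" using self_in_orbit[of x] by auto
  then have "num_cycles ?c (\<alpha>_on ?c) = 1" by (simp add: num_cycles_def cycles_def)
  then show ?thesis by (simp add: num_cycles_eq_cyc finite_orbit_\<alpha> \<alpha>_on_permutes)
qed

lemma refinement_iff:
  assumes \<beta>: "\<beta> permutes {1..n}" "\<And>i. i \<in> {1..n} \<Longrightarrow> \<beta> i \<in> orbit \<alpha> i"
  shows "refinement n \<beta> \<alpha> \<longleftrightarrow> (\<forall>x \<in> {1..n}. let c = orbit \<alpha> x in
    cyc c (perm_restrict \<beta> c) + cyc c (inv' (perm_restrict \<beta> c) \<circ> \<alpha>_on c) = card c + 1)"
proof -
  have p: "perm_restrict \<beta> (orbit \<alpha> x) permutes orbit \<alpha> x" if "x \<in> {1..n}" for x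
    using \<beta>(2) orbit_eq orbit_\<alpha>_subset[OF that]
    by (intro perm_restrict_permutes[OF \<beta>(1) finite_orbit_\<alpha>]) blast
  moreover have "inv' (perm_restrict \<beta> (orbit \<alpha> x)) \<circ> \<alpha>_on (orbit \<alpha> x) permutes orbit \<alpha> x" if "x \<in> {1..n}" for x
    by (intro permutes_compose permutes_inv p[OF that] \<alpha>_on_permutes)
  ultimately show ?thesis
    using \<beta>(1) unfolding refinement_def cycles_def
    by (simp add: num_cycles_eq_cyc finite_orbit_\<alpha> Let_def)
qed

lemma refinement_in_orbit:
  assumes "refinement n \<beta> \<alpha>" "i \<in> {1..n}" shows "\<beta> i \<in> orbit \<alpha> i"
proof -
  have "perm_restrict \<beta> (orbit \<alpha> i) permutes orbit \<alpha> i"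
    using assms cycleI by (auto simp: refinement_def)
  then show ?thesis using permutes_in_image self_in_orbit[of i] by (metis perm_restrict_simps(1))
qed

lemma outcomesE:
  assumes "C \<in> outcomes n \<alpha> M"
  obtains \<gamma> where "C \<subseteq> {1..n} \<times> {1..n}"
    and "\<And>i j. (i, j) \<in> C \<Longrightarrow> j \<noteq> \<alpha> i \<and> cut_curve n \<alpha> M i j (\<gamma> (i, j))"
    and "\<And>i j i' j'. (i, j) \<in> C \<Longrightarrow> (i', j') \<in> C \<Longrightarrow> i = i' \<longleftrightarrow> j = j'"
    and "\<And>i. i \<in> {1..n} \<Longrightarrow> i \<notin> fst ` C \<longleftrightarrow> \<alpha> i \<notin> snd ` C"
    and "\<And>p q. p \<in> C \<Longrightarrow> q \<in> C \<Longrightarrow> p \<noteq> q \<Longrightarrow> path_image (\<gamma> p) \<inter> path_image (\<gamma> q) = {}"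
proof -
  from assms obtain \<gamma> where 1: "C \<subseteq> {1..n} \<times> {1..n}"
    and 2: "\<forall>(i, j) \<in> C. j \<noteq> \<alpha> i \<and> cut_curve n \<alpha> M i j (\<gamma> (i, j))"
    and 3: "\<forall>(i, j) \<in> C. \<forall>(i', j') \<in> C. i = i' \<longleftrightarrow> j = j'"
    and 4: "\<forall>i \<in> {1..n}. i \<notin> fst ` C \<longleftrightarrow> \<alpha> i \<notin> snd ` C"
    and 5: "\<forall>p \<in> C. \<forall>q \<in> C. p \<noteq> q \<longrightarrow> path_image (\<gamma> p) \<inter> path_image (\<gamma> q) = {}"
    unfolding outcomes_def mem_Collect_eq by (elim conjE exE)
  show ?thesis
  proof (rule that)
    show "j \<noteq> \<alpha> i \<and> cut_curve n \<alpha> M i j (\<gamma> (i, j))" if "(i, j) \<in> C" for i j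
      using bspec[OF 2 that] by simp
    show "i = i' \<longleftrightarrow> j = j'" if "(i, j) \<in> C" "(i', j') \<in> C" for i j i' j'
      using bspec[OF 3 that(1)] that(2) by auto
  qed (use 1 4 5 in simp_all)
qed

lemma outcome_is_cut_pairs:
  assumes C: "C \<in> outcomes n \<alpha> M"
  shows "cut_perm \<alpha> C permutes {1..n}"
    and "\<And>i. i \<in> {1..n} \<Longrightarrow> cut_perm \<alpha> C i \<in> orbit \<alpha> i"
    and "cut_pairs n \<alpha> (cut_perm \<alpha> C) = C"
proof -
  let ?\<beta> = "cut_perm \<alpha> C"
  obtain \<gamma> where sub: "C \<subseteq> {1..n} \<times> {1..n}"
    and \<gamma>: "\<And>i j. (i, j) \<in> C \<Longrightarrow> j \<noteq> \<alpha> i \<and> cut_curve n \<alpha> M i j (\<gamma> (i, j))"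
    and R2: "\<And>i j i' j'. (i, j) \<in> C \<Longrightarrow> (i', j') \<in> C \<Longrightarrow> i = i' \<longleftrightarrow> j = j'"
    and R3: "\<And>i. i \<in> {1..n} \<Longrightarrow> i \<notin> fst ` C \<longleftrightarrow> \<alpha> i \<notin> snd ` C"
    using outcomesE[OF C] by metis
  have in_C: "?\<beta> i = j" if "(i, j) \<in> C" for i j
  proof -
    have "(THE j. (i, j) \<in> C) = j" using that R2 by blast
    then show ?thesis using that by (auto simp: cut_perm_def)
  qed
  have not_C: "?\<beta> i = \<alpha> i" if "i \<notin> fst ` C" for i
    using that by (force simp: cut_perm_def)
  show orb: "?\<beta> i \<in> orbit \<alpha> i" if i: "i \<in> {1..n}" for i
  proof (cases "i \<in> fst ` C")
    case True
    then obtain j where j: "(i, j) \<in> C" by auto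
    then show ?thesis using in_C \<gamma> cut_curveD(2) by blast
  qed (simp add: not_C orbit.base)
  show "?\<beta> permutes {1..n}"
  proof (rule bij_imp_permutes)
    have "inj_on ?\<beta> {1..n}"
    proof (rule inj_onI)
      fix x y assume xy: "x \<in> {1..n}" "y \<in> {1..n}" "?\<beta> x = ?\<beta> y"
      have snd: "?\<beta> z \<in> snd ` C \<longleftrightarrow> z \<in> fst ` C" if "z \<in> {1..n}" for z
      proof (cases "z \<in> fst ` C")
        case True
        then show ?thesis using in_C by force
      next
        case False
        then show ?thesis using not_C R3[OF that] by simp
      qed
      show "x = y"
      proof (cases "x \<in> fst ` C")
        case True
        then have "y \<in> fst ` C" using snd xy by metis
        then show ?thesis using True in_C R2 xy by force
      next
        case False
        then have "y \<notin> fst ` C" using snd xy by metis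
        then have "\<alpha> x = \<alpha> y" using False xy not_C by metis
        then show ?thesis using permutes_inj[OF perm(2)] by (simp add: inj_eq)
      qed
    qed
    moreover have "?\<beta> ` {1..n} \<subseteq> {1..n}" using orb orbit_\<alpha>_subset by blast
    ultimately show "bij_betw ?\<beta> {1..n} {1..n}"
      by (simp add: bij_betw_def endo_inj_surj)
    show "?\<beta> x = x" if "x \<notin> {1..n}" for x
    proof -
      have "x \<notin> fst ` C" using that sub by auto
      then show ?thesis using not_C permutes_not_in[OF perm(2) that] by simp
    qed
  qed
  show "cut_pairs n \<alpha> ?\<beta> = C"
  proof
    show "cut_pairs n \<alpha> ?\<beta> \<subseteq> C"
    proof
      fix p assume "p \<in> cut_pairs n \<alpha> ?\<beta>"
      then obtain i where i: "p = (i, ?\<beta> i)" "?\<beta> i \<noteq> \<alpha> i" by (auto simp: cut_pairs_def)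
      then have "i \<in> fst ` C" using not_C by blast
      then show "p \<in> C" using i in_C by force
    qed
    show "C \<subseteq> cut_pairs n \<alpha> ?\<beta>"
    proof
      fix p assume p: "p \<in> C"
      obtain i j where ij: "p = (i, j)" by force
      then have "?\<beta> i = j" "j \<noteq> \<alpha> i" "i \<in> {1..n}" using p in_C \<gamma> sub by auto
      then show "p \<in> cut_pairs n \<alpha> ?\<beta>" using ij by (auto simp: cut_pairs_def)
    qed
  qed
qed

lemma refinement_if_outcome:
  assumes C: "C \<in> outcomes n \<alpha> M"
  shows "refinement n (cut_perm \<alpha> C) \<alpha>"
proof -
  define \<beta> where "\<beta> = cut_perm \<alpha> C"
  note out = outcome_is_cut_pairs[OF C, folded \<beta>_def]
  obtain \<gamma> where \<gamma>: "\<And>i j. (i, j) \<in> C \<Longrightarrow> cut_curve n \<alpha> M i j (\<gamma> (i, j))"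
    and disj: "\<And>p q. p \<in> C \<Longrightarrow> q \<in> C \<Longrightarrow> p \<noteq> q \<Longrightarrow> path_image (\<gamma> p) \<inter> path_image (\<gamma> q) = {}"
    using outcomesE[OF C] by metis
  have cut: "(i, \<beta> i) \<in> C" if "i \<in> {1..n}" "\<beta> i \<noteq> \<alpha> i" for i
    using that unfolding out(3)[symmetric] by (auto simp: cut_pairs_def)
  have "let c = orbit \<alpha> z in
    cyc c (perm_restrict \<beta> c) + cyc c (inv' (perm_restrict \<beta> c) \<circ> \<alpha>_on c) = card c + 1" if z: "z \<in> {1..n}" for z
  proof -
    define c where "c = orbit \<alpha> z"
    let ?a = "\<alpha>_on c" and ?b = "perm_restrict \<beta> c"
    have c_sub: "c \<subseteq> {1..n}" and fin: "finite c" and ne: "c \<noteq> {}"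
      using orbit_\<alpha>_subset[OF z] finite_orbit_\<alpha> self_in_orbit by (auto simp: c_def)
    have c_orb: "orbit \<alpha> y = c" if "y \<in> c" for y using orbit_eq that by (simp add: c_def)
    have \<beta>c: "\<beta> y \<in> c" if "y \<in> c" for y using out(2)[of y] that c_sub c_orb by auto
    have b: "?b permutes c" using \<beta>c by (intro perm_restrict_permutes[OF out(1) fin]) blast
    have a: "?a permutes c" using \<alpha>_on_permutes by (simp add: c_def)
    have "card c + 1 \<le> cyc c ?b + cyc c (inv' ?b \<circ> ?a)"
    proof (rule noncrossing_cyc_ge[OF fin ne b a])
      fix i assume i: "i \<in> c"
      define x where "x = \<beta> i"
      let ?K = "least_power \<alpha> x"
      have xc: "x \<in> c" using \<beta>c[OF i] by (simp add: x_def)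
      have xn: "x \<in> {1..n}" using xc c_sub by blast
      have orb_x: "orbit \<alpha> x = c" using c_orb[OF xc] .
      obtain m where m: "m < ?K" "i = (\<alpha> ^^ m) x" using orbit_index[of i x] i orb_x by blast
      \<comment> \<open>The segment cut off by \<open>i\<close>, both ends included. A cut leaving
        it would cross the cut at \<open>i\<close>, and an uncut point before \<open>i\<close> only
        moves one index on.\<close>
      define A where "A = {(\<alpha> ^^ l) x | l. l \<le> m}"
      have pow_c: "(\<alpha> ^^ l) x \<in> c" for l using funpow_in_orbit[of l x] orb_x by simp
      have "?b ` A \<subseteq> A"
      proof
        fix w assume "w \<in> ?b ` A"
        then obtain r where r: "r \<le> m" "w = ?b ((\<alpha> ^^ r) x)" by (auto simp: A_def)
        define y where "y = (\<alpha> ^^ r) x"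
        have y: "y \<in> c" "w = \<beta> y" using pow_c[of r] r by (simp_all add: y_def perm_restrict_simps)
        obtain s where s: "s < ?K" "w = (\<alpha> ^^ s) x" using orbit_index[of w x] \<beta>c[OF y(1)] y orb_x by blast
        consider "r = m" | "r < m" "\<beta> y = \<alpha> y" | "r < m" "\<beta> y \<noteq> \<alpha> y" using r by linarith
        then show "w \<in> A"
        proof cases
          case 1
          then have "y = i" by (simp only: y_def m(2)[symmetric])
          then have "w = (\<alpha> ^^ 0) x" using y(2) by (simp add: x_def)
          then show ?thesis using le0[of m] unfolding A_def by blast
        next
          case 2
          then have "w = (\<alpha> ^^ Suc r) x" using y by (simp add: y_def)
          then show ?thesis using 2 Suc_leI by (auto simp only: A_def)
        next
          case 3
          show ?thesis
          proof (rule ccontr)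
            assume "w \<notin> A"
            then have sm: "m < s" using s by (auto simp: A_def not_le[symmetric])
            \<comment> \<open>The point \<open>i\<close> must itself be cut: otherwise
              \<open>\<alpha> i = x\<close> closes the cycle at index m, and no index
              \<open>s > m\<close> is left.\<close>
            have "\<beta> i \<noteq> \<alpha> i"
            proof
              assume "\<beta> i = \<alpha> i"
              then have "\<alpha> i = x" by (simp only: x_def)
              then have "(\<alpha> ^^ Suc m) x = (\<alpha> ^^ 0) x" by (simp add: m(2)[symmetric])
              then show False using funpow_eq_iff[of "Suc m" x 0] sm s by simp
            qed
            then have iC: "(i, x) \<in> C" using cut[of i] i c_sub by (auto simp: x_def)
            moreover have yC: "(y, w) \<in> C" using cut[of y] 3 y c_sub by auto
            moreover have "i \<noteq> y" using 3 m funpow_eq_iff[of m x r] by (simp add: y_def)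
            ultimately have "path_image (\<gamma> (i, x)) \<inter> path_image (\<gamma> (y, w)) = {}" by (intro disj) auto
            moreover have "path_image (\<gamma> (i, x)) \<inter> path_image (\<gamma> (y, w)) \<noteq> {}"
              using \<gamma>[OF iC] \<gamma>[OF yC] 3 s sm m
              by (intro cuts_cross[OF xn, of r m s]) (simp_all add: y_def)
            ultimately show False by blast
          qed
        qed
      qed
      moreover have "?a ` (A - {i}) \<subseteq> A"
      proof
        fix w assume "w \<in> ?a ` (A - {i})"
        then obtain r where r: "r \<le> m" "(\<alpha> ^^ r) x \<noteq> i" "w = ?a ((\<alpha> ^^ r) x)" by (auto simp: A_def)
        then have "Suc r \<le> m" using m by (metis Suc_leI le_neq_implies_less)
        moreover have "w = (\<alpha> ^^ Suc r) x" using r pow_c[of r] by (simp add: perm_restrict_simps)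
        ultimately show "w \<in> A" unfolding A_def by blast
      qed
      \<comment> \<open>Only the predecessor of \<open>x\<close>, which has the last index
        \<open>?K - 1\<close>, is mapped to \<open>x\<close>. It lies in \<open>A\<close> only if it
        is \<open>i\<close>.\<close>
      moreover have "y = i" if y: "y \<in> A" "?a y = ?b i" for y
      proof -
        obtain r where r: "r \<le> m" "y = (\<alpha> ^^ r) x" using y by (auto simp: A_def)
        then have "(\<alpha> ^^ Suc r) x = (\<alpha> ^^ 0) x"
          using y(2) i pow_c[of r] by (simp add: perm_restrict_simps x_def)
        then have "\<not> Suc r < ?K" using funpow_eq_iff[of "Suc r" x 0] least_power_pos by auto
        then have "r = m" using r m by linarith
        then show ?thesis using r m by simp
      qed
      moreover have "A \<subseteq> c" "i \<in> A" using pow_c m by (auto simp: A_def)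
      ultimately show "\<exists>A \<subseteq> c. i \<in> A \<and> ?b ` A \<subseteq> A \<and> ?a ` (A - {i}) \<subseteq> A \<and> (\<forall>y \<in> A. ?a y = ?b i \<longrightarrow> y = i)"
        by blast
    qed
    moreover have "cyc c ?b + cyc c (inv' ?b \<circ> ?a) \<le> card c + 1"
      using cyc_le[OF fin b a] cyc_\<alpha>_on[of z] by (simp add: c_def)
    ultimately show ?thesis by (simp add: c_def Let_def)
  qed
  then show ?thesis using refinement_iff[OF out(1,2)] unfolding \<beta>_def by blast
qed

text \<open>Chords in different hyperedges lie in disjoint areas. In the same hyperedge, one
  geodesic step at \<open>i\<close> breaks the cycle into the indices 0, ..., m and the rest. By
  \<open>geodesic_separates\<close>, \<open>\<beta>\<close> does not connect the two parts, so
  \<open>y\<close> and \<open>\<beta> y\<close> lie on the same side of the chord at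
  \<open>i\<close>.\<close>

lemma refinement_chords_disjoint:
  assumes \<beta>: "refinement n \<beta> \<alpha>"
    and i: "i \<in> {1..n}" "\<beta> i \<noteq> \<alpha> i" and y: "y \<in> {1..n}" "\<beta> y \<noteq> \<alpha> y" "y \<noteq> i"
  shows "path_image (chord (i, \<beta> i)) \<inter> path_image (chord (y, \<beta> y)) = {}"
proof -
  have \<beta>p: "\<beta> permutes {1..n}" using \<beta> by (simp add: refinement_def)
  have \<beta>o: "\<beta> k \<in> orbit \<alpha> k" if "k \<in> {1..n}" for k using refinement_in_orbit[OF \<beta> that] .
  show ?thesis
  proof (cases "y \<in> orbit \<alpha> i")
    case False
    have sub: "path_image (chord (k, \<beta> k)) \<subseteq> area (par k)" if "k \<in> {1..n}" "\<beta> k \<noteq> \<alpha> k" for k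
      using cut_curve_chord(2)[OF that(1) \<beta>o position_neq] that \<beta>o by blast
    have "orbit \<alpha> i \<noteq> orbit \<alpha> y" using False self_in_orbit[of y] by auto
    then have "area (par i) \<inter> area (par y) = {}"
      using model cycleI[OF i(1)] cycleI[OF y(1)] by (simp add: paper_model_def par_def)
    then show ?thesis using sub[OF i] sub[OF y(1,2)] by blast
  next
    case True
    define c where "c = orbit \<alpha> i"
    let ?a = "\<alpha>_on c" and ?b = "perm_restrict \<beta> c"
    have ic: "i \<in> c" and yc: "y \<in> c" using True self_in_orbit by (auto simp: c_def)
    have c_sub: "c \<subseteq> {1..n}" and fin: "finite c"
      using orbit_\<alpha>_subset[OF i(1)] finite_orbit_\<alpha> by (auto simp: c_def)
    have c_orb: "orbit \<alpha> w = c" if "w \<in> c" for w using orbit_eq that by (simp add: c_def)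
    have \<beta>c: "\<beta> w \<in> c" if "w \<in> c" for w using \<beta>o[of w] that c_sub c_orb by auto
    have b: "?b permutes c" using \<beta>c by (intro perm_restrict_permutes[OF \<beta>p fin]) blast
    have a: "?a permutes c" using \<alpha>_on_permutes by (simp add: c_def)
    have eq: "cyc c ?b + cyc c (inv' ?b \<circ> ?a) = card c + cyc c ?a"
      using \<beta> refinement_iff[OF \<beta>p \<beta>o] i(1) cyc_\<alpha>_on[of i] by (simp add: c_def Let_def)
    define x where "x = \<beta> i"
    let ?K = "least_power \<alpha> x"
    have xc: "x \<in> c" using \<beta>c[OF ic] by (simp add: x_def)
    have xn: "x \<in> {1..n}" using xc c_sub by blast
    have orb_x: "orbit \<alpha> x = c" using c_orb[OF xc] .
    have pow_c: "(\<alpha> ^^ l) x \<in> c" for l using funpow_in_orbit[of l x] orb_x by simp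
    have \<alpha>_pow: "?a ((\<alpha> ^^ l) x) = (\<alpha> ^^ Suc l) x" for l using pow_c[of l] by (simp add: perm_restrict_simps)
    obtain m where m: "m < ?K" "i = (\<alpha> ^^ m) x" using orbit_index[of i x] ic orb_x by blast
    obtain r where r: "r < ?K" "y = (\<alpha> ^^ r) x" using orbit_index[of y x] yc orb_x by blast
    obtain s where s: "s < ?K" "\<beta> y = (\<alpha> ^^ s) x" using orbit_index[of "\<beta> y" x] \<beta>c[OF yc] orb_x by blast
    have rm: "r \<noteq> m" using r m y(3) by auto
    have s0: "s \<noteq> 0"
    proof
      assume "s = 0"
      then have "\<beta> y = \<beta> i" using s by (simp add: x_def)
      then show False using y(3) permutes_inj[OF \<beta>p] by (simp add: inj_eq)
    qed
    define k where "k = inv' ?a (?b i)"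
    have bi: "?b i = x" using ic by (simp add: perm_restrict_simps x_def)
    have abi: "?a i \<noteq> ?b i" using ic i(2) by (simp add: perm_restrict_simps)
    have k: "k \<noteq> i" "?a k = x" using inv_apply_neq[OF a b ic abi] bi by (simp_all add: k_def)
    let ?t = "Transposition.transpose i k"
    define R where "R = edges c ?b \<union> edges c (?a \<circ> ?t)"
    have sep: "(i, k) \<notin> conn R"
      using geodesic_separates[OF fin b a eq ic abi] by (simp only: k_def R_def not_False_eq_True)
    have k_pow: "k = (\<alpha> ^^ (?K - 1)) x"
    proof -
      have "Suc (?K - 1) = ?K" using least_power_pos[of x] by simp
      then have "?a ((\<alpha> ^^ (?K - 1)) x) = ?a k" using \<alpha>_pow[of "?K - 1"] funpow_least_power[of x] k(2) by simp
      then show ?thesis using permutes_inj[OF a] by (simp add: inj_eq)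
    qed
    \<comment> \<open>Away from \<open>i\<close> and \<open>k\<close>, which are the last points of
      the two segments, the step still moves one index on; hence each segment is connected in
      \<open>R\<close>.\<close>
    have next_conn: "((\<alpha> ^^ l) x, (\<alpha> ^^ Suc l) x) \<in> conn R" if "l \<noteq> m" "l < ?K - 1" for l
    proof -
      have "(\<alpha> ^^ l) x \<noteq> i" "(\<alpha> ^^ l) x \<noteq> k"
        using funpow_eq_iff[of l x m] funpow_eq_iff[of l x "?K - 1"] that m k_pow by auto
      then have "(?a \<circ> ?t) ((\<alpha> ^^ l) x) = (\<alpha> ^^ Suc l) x" using \<alpha>_pow[of l] by (simp add: Transposition.transpose_def)
      then have "((\<alpha> ^^ l) x, (\<alpha> ^^ Suc l) x) \<in> edges c (?a \<circ> ?t)" using pow_c[of l] by (simp add: edges_iff)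
      then show ?thesis unfolding R_def by (intro conn_edge UnI2)
    qed
    have low: "((\<alpha> ^^ l) x, i) \<in> conn R" if "l \<le> m" for l
      using that
    proof (induction rule: inc_induct)
      case base
      then show ?case using m by simp
    next
      case (step l)
      have "((\<alpha> ^^ l) x, (\<alpha> ^^ Suc l) x) \<in> conn R" using step(2) m by (intro next_conn) auto
      then show ?case using step(3) by (rule conn_trans)
    qed
    have high: "((\<alpha> ^^ l) x, k) \<in> conn R" if "m < l" "l \<le> ?K - 1" for l
      using that(2,1)
    proof (induction rule: inc_induct)
      case base
      then show ?case using k_pow by simp
    next
      case (step l)
      have "((\<alpha> ^^ l) x, (\<alpha> ^^ Suc l) x) \<in> conn R" using step(2,4) by (intro next_conn) auto
      moreover have "((\<alpha> ^^ Suc l) x, k) \<in> conn R" using step(3,4) by simp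
      ultimately show ?case by (rule conn_trans)
    qed
    have side: "((\<alpha> ^^ l) x, i) \<in> conn R \<longleftrightarrow> l \<le> m" if "l < ?K" for l
    proof
      assume c: "((\<alpha> ^^ l) x, i) \<in> conn R"
      show "l \<le> m"
      proof (rule ccontr)
        assume "\<not> l \<le> m"
        then have "((\<alpha> ^^ l) x, k) \<in> conn R" using high that by simp
        then have "(i, k) \<in> conn R" using c conn_sym conn_trans by metis
        then show False using sep by blast
      qed
    qed (rule low)
    have "(y, \<beta> y) \<in> edges c ?b" using yc by (simp add: edges_iff perm_restrict_simps)
    then have "(y, \<beta> y) \<in> conn R" unfolding R_def by (intro conn_edge UnI1)
    then have "(y, i) \<in> conn R \<longleftrightarrow> (\<beta> y, i) \<in> conn R" using conn_sym conn_trans by metis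
    then have "r \<le> m \<longleftrightarrow> s \<le> m" using side[OF r(1)] side[OF s(1)] r s by simp
    then have "path_image (chord ((\<alpha> ^^ m) x, x)) \<inter> path_image (chord ((\<alpha> ^^ r) x, (\<alpha> ^^ s) x)) = {}"
      using rm s0 by (intro chords_do_not_cross[OF xn m(1) r(1) s(1)]) auto
    then show ?thesis by (simp only: x_def[symmetric] m(2)[symmetric] r(2)[symmetric] s(2)[symmetric])
  qed
qed

lemma outcome_if_refinement:
  assumes \<beta>: "refinement n \<beta> \<alpha>"
  shows "cut_pairs n \<alpha> \<beta> \<in> outcomes n \<alpha> M"
proof -
  let ?C = "cut_pairs n \<alpha> \<beta>"
  have \<beta>p: "\<beta> permutes {1..n}" using \<beta> by (simp add: refinement_def)
  have \<beta>o: "\<beta> k \<in> orbit \<alpha> k" if "k \<in> {1..n}" for k using refinement_in_orbit[OF \<beta> that] .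
  have inj: "\<beta> x = \<beta> y \<longleftrightarrow> x = y" "\<alpha> x = \<alpha> y \<longleftrightarrow> x = y" for x y
    using permutes_inj[OF \<beta>p] permutes_inj[OF perm(2)] by (simp_all add: inj_eq)
  have curve: "cut_curve n \<alpha> M k (\<beta> k) (chord (k, \<beta> k))" if "k \<in> {1..n}" "\<beta> k \<noteq> \<alpha> k" for k
    using cut_curve_chord(1)[OF that(1) \<beta>o position_neq] that \<beta>o by blast
  have fst_C: "i \<in> fst ` ?C \<longleftrightarrow> i \<in> {1..n} \<and> \<beta> i \<noteq> \<alpha> i" for i
    by (force simp: cut_pairs_def)
  have snd_C: "\<alpha> i \<in> snd ` ?C \<longleftrightarrow> \<beta> i \<noteq> \<alpha> i" if i: "i \<in> {1..n}" for i
  proof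
    assume "\<alpha> i \<in> snd ` ?C"
    then obtain j where "\<alpha> i = \<beta> j" "\<beta> j \<noteq> \<alpha> j" by (auto simp: cut_pairs_def)
    then show "\<beta> i \<noteq> \<alpha> i" using inj by metis
  next
    assume ne: "\<beta> i \<noteq> \<alpha> i"
    define j where "j = inv' \<beta> (\<alpha> i)"
    have j: "\<beta> j = \<alpha> i" using \<beta>p by (simp add: j_def permutes_inverses)
    moreover have "\<alpha> i \<in> {1..n}" using permutes_in_image[OF perm(2)] i by blast
    then have "j \<in> {1..n}" using permutes_in_image[OF \<beta>p, of j] j by simp
    moreover have "\<beta> j \<noteq> \<alpha> j" using j ne inj by metis
    ultimately have "(j, \<alpha> i) \<in> ?C" by (force simp: cut_pairs_def)
    then show "\<alpha> i \<in> snd ` ?C" by force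
  qed
  have "\<beta> i \<in> {1..n}" if "i \<in> {1..n}" for i using that permutes_in_image[OF \<beta>p] by blast
  then have "?C \<subseteq> {1..n} \<times> {1..n}" unfolding cut_pairs_def by blast
  moreover have "\<forall>(i, j) \<in> ?C. j \<noteq> \<alpha> i \<and> cut_curve n \<alpha> M i j (chord (i, j))"
    using curve by (auto simp: cut_pairs_def)
  moreover have "\<forall>(i, j) \<in> ?C. \<forall>(i', j') \<in> ?C. i = i' \<longleftrightarrow> j = j'"
    using inj by (auto simp: cut_pairs_def)
  moreover have "\<forall>i \<in> {1..n}. i \<notin> fst ` ?C \<longleftrightarrow> \<alpha> i \<notin> snd ` ?C"
    using fst_C snd_C by blast
  moreover have "\<forall>p \<in> ?C. \<forall>q \<in> ?C. p \<noteq> q \<longrightarrow> path_image (chord p) \<inter> path_image (chord q) = {}"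
  proof (intro ballI impI)
    fix p q assume "p \<in> ?C" "q \<in> ?C" "p \<noteq> q"
    then obtain i y where "p = (i, \<beta> i)" "q = (y, \<beta> y)" "i \<in> {1..n}" "y \<in> {1..n}" "\<beta> i \<noteq> \<alpha> i" "\<beta> y \<noteq> \<alpha> y" "y \<noteq> i"
      by (auto simp: cut_pairs_def)
    then show "path_image (chord p) \<inter> path_image (chord q) = {}"
      using refinement_chords_disjoint[OF \<beta>] by blast
  qed
  ultimately show ?thesis
    unfolding outcomes_def mem_Collect_eq by (intro conjI exI[of _ chord])
qed

end

section \<open>Counting coastlines\<close>

lemma permutes_conn_inv:
  assumes "p permutes S" "x \<in> S" shows "(x, inv' p x) \<in> conn (edges S p)"
proof -
  have "inv' p x \<in> S" using assms permutes_in_image[OF permutes_inv[OF assms(1)]] by blast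
  then have "(inv' p x, x) \<in> edges S p" using assms(1) by (simp add: edges_iff permutes_inverses)
  then show ?thesis by (intro conn_sym[OF conn_edge])
qed

text \<open>Products of generators correspond to paths, and inverses of generators to edges followed
  backwards.\<close>

lemma components_eq_conn:
  assumes s: "\<sigma> permutes {1..n}" and a: "\<alpha> permutes {1..n}"
  shows "components n \<sigma> \<alpha> = (\<lambda>i. conn (edges {1..n} \<sigma> \<union> edges {1..n} \<alpha>) `` {i}) ` {1..n}"
proof -
  define R where "R = edges {1..n} \<sigma> \<union> edges {1..n} \<alpha>"
  let ?G = "generate (sym_group n) {\<sigma>, \<alpha>}"
  have sub: "conn (edges {1..n} \<sigma>) \<subseteq> conn R" "conn (edges {1..n} \<alpha>) \<subseteq> conn R"
    unfolding R_def by (intro conn_mono; blast)+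
  have RS: "R \<subseteq> {1..n} \<times> {1..n}" using edges_subset[OF s] edges_subset[OF a] by (auto simp: R_def)
  have inv: "inv\<^bsub>sym_group n\<^esub> h = inv' h" if "h \<in> {\<sigma>, \<alpha>}" for h
    using that s a by (intro sym_group_inv_equality) (auto simp: sym_group_carrier)
  have gen: "(x, g x) \<in> conn R" if "g \<in> ?G" "x \<in> {1..n}" for g x
    using that
  proof (induction arbitrary: x)
    case one
    then show ?case by (simp add: sym_group_one)
  next
    case (incl h)
    then have "(x, h x) \<in> R" by (auto simp: R_def edges_iff)
    then show ?case by (rule conn_edge)
  next
    case (inv h)
    then have "(x, inv' h x) \<in> conn R"
      using permutes_conn_inv[OF s] permutes_conn_inv[OF a] sub by blast
    then show ?case using \<open>\<And>h. h \<in> {\<sigma>, \<alpha>} \<Longrightarrow> inv\<^bsub>sym_group n\<^esub> h = inv' h\<close>[OF inv(1)] by simp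
  next
    case (eng h1 h2)
    have "(x, h2 x) \<in> conn R" by (rule eng.IH(2)[OF eng.prems])
    moreover from this have "h2 x \<in> {1..n}" using RS eng.prems by (rule conn_in)
    then have "(h2 x, h1 (h2 x)) \<in> conn R" by (rule eng.IH(1))
    ultimately show ?case by (simp add: sym_group_mult conn_trans)
  qed
  have "\<exists>g \<in> ?G. y = g x" if "(x, y) \<in> conn R" for x y
    using that unfolding conn_def
  proof (induction rule: rtrancl_induct)
    case base
    then show ?case using generate.one[of "sym_group n" "{\<sigma>, \<alpha>}"] by (metis id_apply sym_group_one)
  next
    case (step y z)
    then obtain g where g: "g \<in> ?G" "y = g x" by blast
    have "\<exists>h \<in> ?G. z = h y"
    proof (cases "(y, z) \<in> R")
      case True
      then show ?thesis by (auto simp: R_def edges_iff intro: generate.incl)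
    next
      case False
      then obtain h where h: "h \<in> {\<sigma>, \<alpha>}" "y = h z" using step(2) by (auto simp: R_def edges_iff)
      then have "inj h" using permutes_inj[OF s] permutes_inj[OF a] by auto
      then have "z = inv' h y" using h by simp
      moreover have "inv' h \<in> ?G" using generate.inv[OF h(1), of "sym_group n"] inv[OF h(1)] by simp
      ultimately show ?thesis by blast
    qed
    then obtain h where h: "h \<in> ?G" "z = h y" by blast
    have "h \<circ> g \<in> ?G" using generate.eng[OF h(1) g(1)] by (simp add: sym_group_mult)
    then show ?case using h g by (auto intro!: bexI[of _ "h \<circ> g"])
  qed
  then have "{g i | g. g \<in> ?G} = conn R `` {i}" if "i \<in> {1..n}" for i
    using gen[OF _ that] by blast
  then show ?thesis unfolding components_def R_def by (intro image_cong) auto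
qed

lemma num_components_eq:
  assumes "\<sigma> permutes {1..n}" "\<alpha> permutes {1..n}"
  shows "num_components n \<sigma> \<alpha> = num_classes {1..n} (edges {1..n} \<sigma> \<union> edges {1..n} \<alpha>)"
  by (simp add: num_components_def components_eq_conn[OF assms] num_classes_def)

lemma num_cycles_partition:
  assumes a: "\<alpha> permutes S" and S: "finite S" and p: "\<And>c x. c \<in> cycles S \<alpha> \<Longrightarrow> x \<in> c \<Longrightarrow> p x \<in> c"
  shows "num_cycles S p = (\<Sum>c \<in> cycles S \<alpha>. num_cycles c (perm_restrict p c))"
proof -
  have "permutation \<alpha>" using a S by (intro permutes_imp_permutation)
  then have self: "x \<in> orbit \<alpha> x" for x by (rule permutation_self_in_orbit)
  have fin: "finite c" if "c \<in> cycles S \<alpha>" for c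
    using that finite_orbit[OF self] by (auto simp: cycles_def)
  have US: "\<Union> (cycles S \<alpha>) = S"
    using self permutes_orbit_subset[OF a] by (auto simp: cycles_def)
  have disj: "c = d" if "c \<in> cycles S \<alpha>" "d \<in> cycles S \<alpha>" "x \<in> c" "x \<in> d" for c d x
    using that self orbit_trans orbit_swap[OF self] unfolding cycles_def
    by (smt (verit, best) image_iff subsetI subset_antisym)
  have orb: "orbit (perm_restrict p c) x = orbit p x" and orb_sub: "orbit p x \<subseteq> c"
    if c: "c \<in> cycles S \<alpha>" "x \<in> c" for c x
  proof -
    have sub: "y \<in> c \<and> y \<in> orbit (perm_restrict p c) x" if "y \<in> orbit p x" for y
      using that
    proof induction
      case base
      then show ?case using c p[OF c] orbit.base[of "perm_restrict p c" x] by (simp add: perm_restrict_simps)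
    next
      case (step y)
      then show ?case using c p[OF c(1), of y] orbit.step[of y "perm_restrict p c" x] by (simp add: perm_restrict_simps)
    qed
    have "y \<in> c \<and> y \<in> orbit p x" if "y \<in> orbit (perm_restrict p c) x" for y
      using that
    proof induction
      case base
      then show ?case using c p[OF c] orbit.base[of p x] by (simp add: perm_restrict_simps)
    next
      case (step y)
      then show ?case using c p[OF c(1), of y] orbit.step[of y p x] by (simp add: perm_restrict_simps)
    qed
    then show "orbit (perm_restrict p c) x = orbit p x" using sub by blast
    show "orbit p x \<subseteq> c" using sub by blast
  qed
  have "cycles S p = (\<Union>c \<in> cycles S \<alpha>. orbit p ` c)"
    unfolding cycles_def[of S p] using US by blast
  moreover have "card (\<Union>c \<in> cycles S \<alpha>. orbit p ` c) = (\<Sum>c \<in> cycles S \<alpha>. card (orbit p ` c))"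
  proof (rule card_UN_disjoint)
    show "finite (cycles S \<alpha>)" using S by (simp add: cycles_def)
    show "\<forall>c \<in> cycles S \<alpha>. finite (orbit p ` c)" using fin by blast
    show "\<forall>c \<in> cycles S \<alpha>. \<forall>d \<in> cycles S \<alpha>. c \<noteq> d \<longrightarrow> orbit p ` c \<inter> orbit p ` d = {}"
    proof (intro ballI impI)
      fix c d assume cd: "c \<in> cycles S \<alpha>" "d \<in> cycles S \<alpha>" "c \<noteq> d"
      have "orbit p x \<noteq> orbit p y" if "x \<in> c" "y \<in> d" for x y
        using orb_sub[OF cd(1) that(1)] orb_sub[OF cd(2) that(2)] disj[OF cd(1,2), of "p x"] cd(3) orbit.base[of p x]
        by blast
      then show "orbit p ` c \<inter> orbit p ` d = {}" by blast
    qed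
  qed
  moreover have "orbit p ` c = orbit (perm_restrict p c) ` c" if "c \<in> cycles S \<alpha>" for c
    using orb[OF that] by (metis image_cong)
  ultimately show ?thesis by (simp add: num_cycles_def cycles_def[of _ "perm_restrict p _"])
qed

text \<open>The local equations are summed over the cycles of \<open>\<alpha>\<close>. A refinement
  preserves each of these cycles, so taking inverses commutes with restricting to one, and the cycle
  counts add up.\<close>

lemma refinement_geodesic:
  assumes a: "\<alpha> permutes {1..n}" and \<beta>: "refinement n \<beta> \<alpha>"
  shows "cyc {1..n} \<beta> + cyc {1..n} (inv' \<beta> \<circ> \<alpha>) = n + cyc {1..n} \<alpha>"
proof -
  let ?S = "{1..n}" and ?P = "cycles {1..n} \<alpha>"
  have b: "\<beta> permutes ?S" using \<beta> by (simp add: refinement_def)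
  have bp: "perm_restrict \<beta> c permutes c" if "c \<in> ?P" for c
    using \<beta> that by (simp add: refinement_def)
  have \<beta>c: "\<beta> x \<in> c" if "c \<in> ?P" "x \<in> c" for c x
    using permutes_in_image[OF bp[OF that(1)], of x] that by (simp add: perm_restrict_simps)
  have \<alpha>c: "\<alpha> x \<in> c" if "c \<in> ?P" "x \<in> c" for c x
    using that by (auto simp: cycles_def intro: orbit.step)
  have inv_on: "inv' (perm_restrict \<beta> c) \<circ> perm_restrict \<alpha> c = perm_restrict (inv' \<beta> \<circ> \<alpha>) c"
    and inv_in: "x \<in> c \<Longrightarrow> inv' \<beta> (\<alpha> x) \<in> c" if c: "c \<in> ?P" for c x
  proof -
    have *: "inv' (perm_restrict \<beta> c) y = inv' \<beta> y \<and> inv' \<beta> y \<in> c" if y: "y \<in> c" for y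
    proof -
      let ?z = "inv' (perm_restrict \<beta> c) y"
      have z: "?z \<in> c" using permutes_in_image[OF permutes_inv[OF bp[OF c]]] y by blast
      moreover have "perm_restrict \<beta> c ?z = y" using bp[OF c] by (simp add: permutes_inverses)
      ultimately have "\<beta> ?z = y" by (simp add: perm_restrict_simps)
      then have "inv' \<beta> y = ?z" using b by (metis permutes_inverses(2))
      then show ?thesis using z by simp
    qed
    show "inv' (perm_restrict \<beta> c) \<circ> perm_restrict \<alpha> c = perm_restrict (inv' \<beta> \<circ> \<alpha>) c"
    proof
      fix x
      have "inv' (perm_restrict \<beta> c) x = x" if "x \<notin> c"
        using permutes_not_in[OF permutes_inv[OF bp[OF c]] that] .
      then show "(inv' (perm_restrict \<beta> c) \<circ> perm_restrict \<alpha> c) x = perm_restrict (inv' \<beta> \<circ> \<alpha>) c x"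
        using *[of "\<alpha> x"] \<alpha>c[OF c, of x] by (cases "x \<in> c") (simp_all add: perm_restrict_simps)
    qed
    show "inv' \<beta> (\<alpha> x) \<in> c" if "x \<in> c" using *[OF \<alpha>c[OF c that]] by simp
  qed
  have "num_cycles ?S \<beta> + num_cycles ?S (inv' \<beta> \<circ> \<alpha>) = (\<Sum>c \<in> ?P. num_cycles c (perm_restrict \<beta> c) +
      num_cycles c (inv' (perm_restrict \<beta> c) \<circ> perm_restrict \<alpha> c))"
    using num_cycles_partition[OF a _ \<beta>c] num_cycles_partition[OF a, of "inv' \<beta> \<circ> \<alpha>"] inv_in
    by (simp add: sum.distrib inv_on)
  also have "\<dots> = (\<Sum>c \<in> ?P. card c + 1)"
    using \<beta> by (intro sum.cong) (auto simp: refinement_def)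
  also have "\<dots> = (\<Sum>c \<in> ?P. card c) + num_cycles ?S \<alpha>"
    by (simp only: sum.distrib num_cycles_def) simp
  \<comment> \<open>The sizes are summed by applying the partition of cycles to the identity, whose
    cycles are the points.\<close>
  also have "(\<Sum>c \<in> ?P. card c) = n"
  proof -
    have "num_cycles ?S id = card ?S" by (simp add: num_cycles_eq_cyc permutes_id cyc_id)
    moreover have "num_cycles c (perm_restrict id c) = card c" if c: "c \<in> ?P" for c
    proof -
      have "c \<subseteq> {1..n}" using c permutes_orbit_subset[OF a] unfolding cycles_def by blast
      then have "finite c" by (rule finite_subset) simp
      moreover have "perm_restrict id c = id" by (auto simp: perm_restrict_def)
      ultimately show ?thesis by (simp add: num_cycles_eq_cyc permutes_id cyc_id)
    qed
    ultimately show ?thesis using num_cycles_partition[OF a, of id] by simp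
  qed
  finally have "num_cycles ?S \<beta> + num_cycles ?S (inv' \<beta> \<circ> \<alpha>) = n + num_cycles ?S \<alpha>" .
  moreover have "inv' \<beta> \<circ> \<alpha> permutes ?S" using a b by (intro permutes_compose permutes_inv)
  ultimately show ?thesis using a b by (simp only: num_cycles_eq_cyc finite_atLeastAtMost)
qed

text \<open>Squeezed between nonnegativity and the defect of \<open>\<alpha>\<close>, which is twice
  the genus because there is one component.\<close>

lemma planar_refinement_defect:
  assumes h: "planar_hypermap n \<sigma> \<alpha>" and \<beta>: "refinement n \<beta> \<alpha>"
  shows "defect {1..n} \<sigma> \<beta> = 0"
proof -
  have p: "\<sigma> permutes {1..n}" "\<alpha> permutes {1..n}" and b: "\<beta> permutes {1..n}"
    and k: "num_components n \<sigma> \<alpha> = 1"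
    using h \<beta> by (auto simp: planar_hypermap_def hypermap_def refinement_def)
  have f: "inv' \<alpha> \<circ> \<sigma> permutes {1..n}" using p by (intro permutes_compose permutes_inv)
  \<comment> \<open>\<open>defect\<close> counts faces by the inverse of the permutation used in
    \<open>genus\<close>.\<close>
  have "cyc {1..n} (inv' \<sigma> \<circ> \<alpha>) = cyc {1..n} (inv' \<alpha> \<circ> \<sigma>)"
    using cyc_inv[OF f] p by (simp add: o_inv_distrib permutes_bij bij_imp_bij_inv inv_inv_eq)
  then have "defect {1..n} \<sigma> \<alpha> = 0"
    using h k p f unfolding planar_hypermap_def genus_def defect_def
    by (simp add: num_components_eq num_cycles_eq_cyc)
  moreover have "defect {1..n} \<sigma> \<beta> \<le> defect {1..n} \<sigma> \<alpha>"
    using refinement_geodesic[OF p(2) \<beta>] by (intro defect_geodesic_le p b) simp_all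
  ultimately show ?thesis using defect_nonneg[OF _ p(1) b] by simp
qed

lemma card_image_eq:
  assumes "\<And>x y. x \<in> A \<Longrightarrow> y \<in> A \<Longrightarrow> f x = f y \<longleftrightarrow> g x = g y"
  shows "card (f ` A) = card (g ` A)"
proof -
  let ?k = "\<lambda>z. g (inv_into A f z)"
  have k: "?k (f x) = g x" if "x \<in> A" for x
    using assms that by (metis f_inv_into_f imageI inv_into_into)
  then have "inj_on ?k (f ` A)" using assms by (auto intro!: inj_onI)
  moreover have "?k ` f ` A = g ` A" using k by (simp add: image_image)
  ultimately show ?thesis by (metis card_image)
qed

lemma num_classes_image:
  assumes "h ` S' = S" and "\<And>x y. x \<in> S' \<Longrightarrow> y \<in> S' \<Longrightarrow> (x, y) \<in> conn R' \<longleftrightarrow> (h x, h y) \<in> conn R"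
  shows "num_classes S' R' = num_classes S R"
proof -
  have "card ((\<lambda>x. conn R' `` {x}) ` S') = card ((\<lambda>x. conn R `` {h x}) ` S')"
    using assms(2) by (intro card_image_eq) (simp only: conn_class_eq_iff)
  then show ?thesis unfolding num_classes_def assms(1)[symmetric] by (simp only: image_image)
qed

lemma outline_steps_cut_pairs:
  assumes "\<alpha> permutes {1..n}"
  shows "outline_steps n \<sigma> \<alpha> (cut_pairs n \<alpha> \<beta>) =
    {(Plus i, Minus (\<sigma> i)) | i. i \<in> {1..n}} \<union> {(Plus i, Minus (\<beta> i)) | i. i \<in> {1..n}}"
proof -
  have "i \<notin> fst ` cut_pairs n \<alpha> \<beta> \<longleftrightarrow> \<beta> i = \<alpha> i" if "i \<in> {1..n}" for i
    using that by (force simp: cut_pairs_def)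
  then show ?thesis unfolding outline_steps_def by (auto simp: cut_pairs_def)
qed

lemma outlines_eq_classes:
  "outlines n \<sigma> \<alpha> C = (\<lambda>m. conn (outline_steps n \<sigma> \<alpha> C) `` {m}) ` (Minus ` {1..n} \<union> Plus ` {1..n})"
  by (simp add: outlines_def conn_def)

text \<open>Contracting every arc from i^+ to \<sigma>(i)^- to the point i, which is what
  \<open>h\<close> does, turns the step from i^+ to \<beta>(i)^- into the step from i to
  \<sigma>^{-1}(\<beta>(i)).\<close>

lemma card_outlines:
  assumes s: "\<sigma> permutes {1..n}" and a: "\<alpha> permutes {1..n}" and b: "\<beta> permutes {1..n}"
  shows "card (outlines n \<sigma> \<alpha> (cut_pairs n \<alpha> \<beta>)) = cyc {1..n} (inv' \<sigma> \<circ> \<beta>)"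
proof -
  let ?S = "{1..n}" and ?f = "inv' \<sigma> \<circ> \<beta>"
  define R where "R = outline_steps n \<sigma> \<alpha> (cut_pairs n \<alpha> \<beta>)"
  have R: "(v, w) \<in> R \<longleftrightarrow> (\<exists>i \<in> ?S. v = Plus i \<and> (w = Minus (\<sigma> i) \<or> w = Minus (\<beta> i)))" for v w
    unfolding R_def outline_steps_cut_pairs[OF a] by blast
  define h where "h = (\<lambda>m. case m of Plus i \<Rightarrow> i | Minus j \<Rightarrow> inv' \<sigma> j)"
  have h: "h (Plus i) = i" "h (Minus j) = inv' \<sigma> j" for i j by (simp_all add: h_def)
  have f: "?f permutes ?S" using s b by (intro permutes_compose permutes_inv)
  have invS: "inv' \<sigma> j \<in> ?S" if "j \<in> ?S" for j using that permutes_in_image[OF permutes_inv[OF s]] by blast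
  have fwd: "(h x, h y) \<in> conn (edges ?S ?f)" if "(x, y) \<in> conn R" for x y
  proof (rule conn_image[OF that])
    fix v w assume "(v, w) \<in> R"
    then obtain i where i: "i \<in> ?S" "v = Plus i" and w: "w = Minus (\<sigma> i) \<or> w = Minus (\<beta> i)"
      unfolding R by blast
    have "(i, inv' \<sigma> (\<beta> i)) \<in> edges ?S ?f" using i by (simp add: edges_iff)
    then have "(i, inv' \<sigma> (\<beta> i)) \<in> conn (edges ?S ?f)" by (rule conn_edge)
    then show "(h v, h w) \<in> conn (edges ?S ?f)" using w i(2) s by (auto simp: h permutes_inverses)
  qed
  have PM: "(Plus i, Minus (\<sigma> i)) \<in> conn R" "(Plus i, Minus (\<beta> i)) \<in> conn R" if "i \<in> ?S" for i
    using that by (auto simp: R intro: conn_edge)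
  have lift: "(Plus x, Plus y) \<in> conn R" if "(x, y) \<in> conn (edges ?S ?f)" for x y
  proof (rule conn_image[OF that])
    fix y z assume "(y, z) \<in> edges ?S ?f"
    then have y: "y \<in> ?S" and z: "z = ?f y" by (simp_all only: edges_iff)
    have "z \<in> ?S" unfolding z using permutes_in_image[OF f] y by blast
    then have "(Plus z, Minus (\<sigma> z)) \<in> conn R" by (rule PM(1))
    moreover have "\<sigma> z = \<beta> y" using s by (simp add: z permutes_inverses)
    ultimately show "(Plus y, Plus z) \<in> conn R" using PM(2)[OF y] by (metis conn_sym conn_trans)
  qed
  have mark: "(m, Plus (h m)) \<in> conn R" if "m \<in> Minus ` ?S \<union> Plus ` ?S" for m
  proof (cases m)
    case (Minus j)
    then have "inv' \<sigma> j \<in> ?S" using that by (intro invS) auto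
    then have "(Plus (inv' \<sigma> j), Minus j) \<in> conn R" using PM(1)[of "inv' \<sigma> j"] s by (simp add: permutes_inverses)
    then show ?thesis by (simp add: Minus h conn_sym)
  qed (simp add: h)
  have "num_classes (Minus ` ?S \<union> Plus ` ?S) R = num_classes ?S (edges ?S ?f)"
  proof (rule num_classes_image[of h])
    have "h ` Plus ` ?S = ?S" by (simp add: image_image h)
    moreover have "h ` Minus ` ?S \<subseteq> ?S" using invS by (auto simp: h)
    ultimately show "h ` (Minus ` ?S \<union> Plus ` ?S) = ?S" by (simp only: image_Un) blast
    show "(x, y) \<in> conn R \<longleftrightarrow> (h x, h y) \<in> conn (edges ?S ?f)"
      if "x \<in> Minus ` ?S \<union> Plus ` ?S" "y \<in> Minus ` ?S \<union> Plus ` ?S" for x y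
    proof
      assume "(h x, h y) \<in> conn (edges ?S ?f)"
      then have "(Plus (h x), Plus (h y)) \<in> conn R" by (rule lift)
      then show "(x, y) \<in> conn R" using mark[OF that(1)] mark[OF that(2)] by (metis conn_sym conn_trans)
    qed (rule fwd)
  qed
  then show ?thesis by (simp add: outlines_eq_classes R_def cyc_def num_classes_def)
qed

text \<open>Distinct pieces are disjoint and an outline is nonempty, so no curve is the outer one of
  two pieces.\<close>

lemma card_wet_coastlines:
  assumes outer: "outer_outlines n \<sigma> \<alpha> M outer" and C: "C \<in> outcomes n \<alpha> M"
    and p: "\<sigma> permutes {1..n}" "cut_perm \<alpha> C permutes {1..n}"
  shows "card (wet_coastlines n \<sigma> \<alpha> outer C) = num_components n \<sigma> (cut_perm \<alpha> C)"
    and "wet_coastlines n \<sigma> \<alpha> outer C \<subseteq> outlines n \<sigma> \<alpha> C"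
proof -
  let ?P = "pieces n \<sigma> \<alpha> C"
  have o: "outer C K \<in> outlines n \<sigma> \<alpha> C" "outer C K \<subseteq> Minus ` K \<union> Plus ` K" if "K \<in> ?P" for K
    using outer C that by (auto simp: outer_outlines_def bounds_def)
  show "wet_coastlines n \<sigma> \<alpha> outer C \<subseteq> outlines n \<sigma> \<alpha> C"
    using o(1) by (auto simp: wet_coastlines_def)
  define R where "R = edges {1..n} \<sigma> \<union> edges {1..n} (cut_perm \<alpha> C)"
  have P: "?P = (\<lambda>i. conn R `` {i}) ` {1..n}"
    unfolding pieces_def R_def by (rule components_eq_conn[OF p])
  have "inj_on (outer C) ?P"
  proof (rule inj_onI)
    fix K L assume KL: "K \<in> ?P" "L \<in> ?P" "outer C K = outer C L"
    have "outer C K \<noteq> {}" using o(1)[OF KL(1)] unfolding outlines_eq_classes by auto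
    then obtain m where "m \<in> outer C K" by blast
    then have "m \<in> Minus ` K \<union> Plus ` K" "m \<in> Minus ` L \<union> Plus ` L" using o(2) KL by blast+
    then obtain x where x: "x \<in> K" "x \<in> L" by auto
    obtain i j where "K = conn R `` {i}" "L = conn R `` {j}" using KL P by auto
    then show "K = L" using x conn_class_eq_iff by (metis Image_singleton_iff)
  qed
  then show "card (wet_coastlines n \<sigma> \<alpha> outer C) = num_components n \<sigma> (cut_perm \<alpha> C)"
    by (simp add: wet_coastlines_def card_image num_components_def pieces_def)
qed

theorem theorem4p1:
  fixes n :: nat and \<sigma> \<alpha> :: "nat \<Rightarrow> nat" and M :: paper
    and outer :: "(nat \<times> nat) set \<Rightarrow> nat set \<Rightarrow> mark set"
    and u v :: "'a::comm_ring_1"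
  assumes "planar_hypermap n \<sigma> \<alpha>"
    and "paper_model n \<sigma> \<alpha> M"
    and "outer_outlines n \<sigma> \<alpha> M outer"
  shows "(\<Sum>C \<in> outcomes n \<alpha> M.
            u ^ card (wet_coastlines n \<sigma> \<alpha> outer C) * v ^ card (dry_faces n \<sigma> \<alpha> outer C))
         = u * whitney n \<sigma> \<alpha> u v"
proof -
  have p: "\<sigma> permutes {1..n}" "\<alpha> permutes {1..n}" and k: "num_components n \<sigma> \<alpha> = 1"
    using assms(1) by (auto simp: planar_hypermap_def hypermap_def)
  interpret drawing n \<sigma> \<alpha> M using p assms(2) by unfold_locales
  define w where "w \<beta> = u ^ num_components n \<sigma> \<beta> *
    v ^ (num_components n \<sigma> \<beta> + n - num_cycles {1..n} \<beta> - num_cycles {1..n} \<sigma>)" for \<beta>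
  have weight: "u ^ card (wet_coastlines n \<sigma> \<alpha> outer C) * v ^ card (dry_faces n \<sigma> \<alpha> outer C) =
      w (cut_perm \<alpha> C)" if C: "C \<in> outcomes n \<alpha> M" for C
  proof -
    define \<beta> where "\<beta> = cut_perm \<alpha> C"
    note out = outcome_is_cut_pairs[OF C, folded \<beta>_def]
    note wet = card_wet_coastlines[OF assms(3) C p(1), folded \<beta>_def, OF out(1)]
    have "defect {1..n} \<sigma> \<beta> = 0"
      using planar_refinement_defect[OF assms(1) refinement_if_outcome[OF C]] by (simp add: \<beta>_def)
    moreover have "card (outlines n \<sigma> \<alpha> C) = cyc {1..n} (inv' \<sigma> \<circ> \<beta>)"
      using card_outlines[OF p out(1)] out(3) by simp
    moreover have "finite (outlines n \<sigma> \<alpha> C)" by (simp add: outlines_def)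
    then have "card (dry_faces n \<sigma> \<alpha> outer C) = card (outlines n \<sigma> \<alpha> C) - card (wet_coastlines n \<sigma> \<alpha> outer C)"
      and "card (wet_coastlines n \<sigma> \<alpha> outer C) \<le> card (outlines n \<sigma> \<alpha> C)"
      unfolding dry_faces_def using wet(2) by (auto intro: card_Diff_subset card_mono finite_subset)
    moreover have "num_cycles {1..n} \<beta> = cyc {1..n} \<beta>" "num_cycles {1..n} \<sigma> = cyc {1..n} \<sigma>"
      using out(1) p(1) by (simp_all only: num_cycles_eq_cyc finite_atLeastAtMost)
    \<comment> \<open>Euler's formula reads n + 2 \<kappa> = z(\<sigma>) + z(\<beta>) + (number of
      outlines); subtracting the \<kappa> wet outlines leaves the exponent of \<open>v\<close>. No
      subtraction is truncated, since the wet outlines are among all outlines.\<close>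
    ultimately have "card (dry_faces n \<sigma> \<alpha> outer C) =
        num_components n \<sigma> \<beta> + n - num_cycles {1..n} \<beta> - num_cycles {1..n} \<sigma>"
      using wet(1) num_components_eq[OF p(1) out(1)]
      by (simp add: defect_def)
    then show ?thesis using wet(1) by (simp add: w_def \<beta>_def)
  qed
  have "bij_betw (cut_perm \<alpha>) (outcomes n \<alpha> M) {\<beta>. refinement n \<beta> \<alpha>}"
  proof (rule bij_betw_byWitness[of _ "cut_pairs n \<alpha>"])
    show "\<forall>\<beta> \<in> {\<beta>. refinement n \<beta> \<alpha>}. cut_perm \<alpha> (cut_pairs n \<alpha> \<beta>) = \<beta>"
      using cut_perm_cut_pairs[OF _ p(2)] by (simp add: refinement_def)
  qed (auto simp: outcome_is_cut_pairs(3) intro: refinement_if_outcome outcome_if_refinement)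
  then have "(\<Sum>C \<in> outcomes n \<alpha> M. w (cut_perm \<alpha> C)) = (\<Sum>\<beta> | refinement n \<beta> \<alpha>. w \<beta>)"
    by (rule sum.reindex_bij_betw)
  also have "\<dots> = u * whitney n \<sigma> \<alpha> u v"
  proof -
    have "w \<beta> = u * (u ^ (num_components n \<sigma> \<beta> - num_components n \<sigma> \<alpha>) *
        v ^ (num_components n \<sigma> \<beta> + n - num_cycles {1..n} \<beta> - num_cycles {1..n} \<sigma>))"
      if "refinement n \<beta> \<alpha>" for \<beta>
    proof -
      have "\<beta> permutes {1..n}" using that by (simp add: refinement_def)
      \<comment> \<open>One component for \<open>\<alpha>\<close> forces a point to exist, so the
        exponent of \<open>u\<close> in \<open>w\<close> is positive and one factor \<open>u\<close>
        can be split off.\<close>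
      moreover have "n \<noteq> 0" using k by (intro notI) (simp add: num_components_def components_def)
      ultimately have "num_components n \<sigma> \<beta> > 0"
        using num_classes_pos[of "{1..n}"] p(1) by (simp add: num_components_eq)
      then show ?thesis by (simp add: w_def k power_eq_if)
    qed
    then show ?thesis by (simp add: whitney_def sum_distrib_left)
  qed
  finally show ?thesis using weight by simp
qed

end
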